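(* Let $\mathbb{B}$ be the open unit ball of a complex Banach space $X$, let $\omega$ and $\mu$ be normal functions, and let $\varphi\in H(\mathbb{B})$. Then $T_{\varphi}:\mathcal{B}_{\mathcal{R}}(\mathbb{B})_{\omega}\to\mathcal{B}_{\mathcal{R}}(\mathbb{B})_{\mu}$ is bounded if and only if $$\sup_{z\in\mathbb{B}}\mu(z)|\mathcal{R}\varphi(z)|\int_0^{\|z\|}\frac{1}{\omega(t)}\,dt<\infty.$$ Moreover, if $T_{\varphi}:\mathcal{B}_{\mathcal{R}}(\mathbb{B})_{\omega}\to\mathcal{B}_{\mathcal{R}}(\mathbb{B})_{\mu}$ is bounded, then $$\|T_{\varphi}\|\simeq\sup_{z\in\mathbb{B}}\mu(z)|\mathcal{R}\varphi(z)|\int_0^{\|z\|}\frac{1}{\omega(t)}\,dt,$$ i.e. there is a constant $C>0$, independent of $\varphi$, such that $C^{-1}\|T_\varphi\|\le \sup_{z\in\mathbb{B}}\mu(z)|\mathcal{R}\varphi(z)|\int_0^{\|z\|}\frac{1}{\omega(t)}\,dt\le C\|T_\varphi\|$.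
   Context: A positive continuous function $\omega$ on $[0,1)$ is normal if there are constants $\delta\in[0,1)$ and $0<a<b<\infty$ such that on $[\delta,1)$ the function $\omega(r)/(1-r)^a$ is decreasing and $\omega(r)/(1-r)^b$ is increasing. A normal function is extended to $\mathbb{B}$ by $\omega(z)=\omega(\|z\|)$. $H(\mathbb{B})$ is the set of holomorphic functions $\mathbb{B}\to\mathbb{C}$. For $f\in H(\mathbb{B})$, $\mathcal{R}f(z)=Df(z)z$, where $Df(z)$ is the Fréchet derivative of $f$ at $z$. For a normal $\omega$, the Bloch-type space $\mathcal{B}_{\mathcal{R}}(\mathbb{B})_{\omega}$ is the set of $f\in H(\mathbb{B})$ with $\sup_{z\in\mathbb{B}}\omega(z)|\mathcal{R}f(z)|<\infty$, with norm $\|f\|_{\mathcal{R},\omega}=|f(0)|+\sup_{z\in\mathbb{B}}\omega(z)|\mathcal{R}f(z)|$. For $\varphi\in H(\mathbb{B})$, the extended Cesàro operator is $T_{\varphi}f(z)=\int_0^1 f(tz)\,\mathcal{R}\varphi(tz)\,\frac{1}{t}\,dt$ for $f\in H(\mathbb{B})$, $z\in\mathbb{B}$. Saying that $T_\varphi$ is bounded between two spaces means that it maps the first into the second and is a bounded linear operator; $\|T_\varphi\|$ is the operator norm. *)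

theory Defs
  imports "HOL-Analysis.Analysis"
begin

text \<open>Complex Banach spaces: a real Banach space whose real scalar multiplication extends to a
  complex one for which the norm is homogeneous.\<close>

class complex_banach = banach +
  fixes scaleC :: "complex \<Rightarrow> 'a \<Rightarrow> 'a" (infixr "*\<^sub>C" 75)
  assumes scaleC_add_right: "c *\<^sub>C (x + y) = c *\<^sub>C x + c *\<^sub>C y"
    and scaleC_add_left: "(c + d) *\<^sub>C x = c *\<^sub>C x + d *\<^sub>C x"
    and scaleC_scaleC: "c *\<^sub>C d *\<^sub>C x = (c * d) *\<^sub>C x"
    and scaleC_of_real: "complex_of_real r *\<^sub>C x = r *\<^sub>R x"
    and norm_scaleC: "norm (c *\<^sub>C x) = cmod c * norm x"

text \<open>Only the values of a weight on \<open>[0,1)\<close> matter. The monotonicity is non-strict; asking for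
  strict monotonicity gives the same class of weights, since \<open>a\<close> may be decreased and \<open>b\<close>
  increased.\<close>

definition normal_weight :: "(real \<Rightarrow> real) \<Rightarrow> bool" where
  "normal_weight \<omega> \<longleftrightarrow>
     continuous_on {0..<1} \<omega> \<and> (\<forall>r\<in>{0..<1}. 0 < \<omega> r) \<and>
     (\<exists>\<delta> a b. 0 \<le> \<delta> \<and> \<delta> < 1 \<and> 0 < a \<and> a < b \<and>
        antimono_on {\<delta>..<1} (\<lambda>r. \<omega> r / (1 - r) powr a) \<and>
        mono_on {\<delta>..<1} (\<lambda>r. \<omega> r / (1 - r) powr b))"

text \<open>A function on the open unit ball is represented by its extension by zero to the whole space,
  so that equality of representatives is equality on the ball. Holomorphy is complex Frechet
  differentiability, i.e. the library (real) Frechet derivative exists and is complex linear.\<close>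

definition holomorphic_ball :: "('a::complex_banach \<Rightarrow> complex) set" where
  "holomorphic_ball =
     {f. (\<forall>z\<in>ball 0 1. \<exists>D. (f has_derivative D) (at z) \<and> (\<forall>c x. D (c *\<^sub>C x) = c * D x)) \<and>
         (\<forall>z. z \<notin> ball 0 1 \<longrightarrow> f z = 0)}"

definition radial_deriv :: "('a::complex_banach \<Rightarrow> complex) \<Rightarrow> 'a \<Rightarrow> complex" where
  "radial_deriv f z = frechet_derivative f (at z) z"

definition bloch_space :: "(real \<Rightarrow> real) \<Rightarrow> ('a::complex_banach \<Rightarrow> complex) set" where
  "bloch_space \<omega> =
     {f \<in> holomorphic_ball. bdd_above ((\<lambda>z. \<omega> (norm z) * cmod (radial_deriv f z)) ` ball 0 1)}"

definition bloch_norm :: "(real \<Rightarrow> real) \<Rightarrow> ('a::complex_banach \<Rightarrow> complex) \<Rightarrow> real" where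
  "bloch_norm \<omega> f = cmod (f 0) + (SUP z\<in>ball 0 1. \<omega> (norm z) * cmod (radial_deriv f z))"

definition cesaro ::
  "('a::complex_banach \<Rightarrow> complex) \<Rightarrow> ('a \<Rightarrow> complex) \<Rightarrow> 'a \<Rightarrow> complex" where
  "cesaro \<phi> f z =
     (if z \<in> ball 0 1
      then integral {0..1}
             (\<lambda>t::real. f (t *\<^sub>R z) * radial_deriv \<phi> (t *\<^sub>R z) * complex_of_real (1 / t))
      else 0)"

definition bloch_bounded ::
  "(real \<Rightarrow> real) \<Rightarrow> (real \<Rightarrow> real) \<Rightarrow>
     (('a::complex_banach \<Rightarrow> complex) \<Rightarrow> ('a \<Rightarrow> complex)) \<Rightarrow> bool" where
  "bloch_bounded \<omega> \<mu> T \<longleftrightarrow>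
     (\<forall>f\<in>bloch_space \<omega>. T f \<in> bloch_space \<mu>) \<and>
     (\<forall>f\<in>bloch_space \<omega>. \<forall>g\<in>bloch_space \<omega>. T (\<lambda>z. f z + g z) = (\<lambda>z. T f z + T g z)) \<and>
     (\<forall>c. \<forall>f\<in>bloch_space \<omega>. T (\<lambda>z. c * f z) = (\<lambda>z. c * T f z)) \<and>
     (\<exists>K. \<forall>f\<in>bloch_space \<omega>. bloch_norm \<mu> (T f) \<le> K * bloch_norm \<omega> f)"

definition bloch_opnorm ::
  "(real \<Rightarrow> real) \<Rightarrow> (real \<Rightarrow> real) \<Rightarrow>
     (('a::complex_banach \<Rightarrow> complex) \<Rightarrow> ('a \<Rightarrow> complex)) \<Rightarrow> real" where
  "bloch_opnorm \<omega> \<mu> T =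
     (SUP f\<in>{f \<in> bloch_space \<omega>. bloch_norm \<omega> f \<le> 1}. bloch_norm \<mu> (T f))"

definition cesaro_weight ::
  "(real \<Rightarrow> real) \<Rightarrow> (real \<Rightarrow> real) \<Rightarrow> ('a::complex_banach \<Rightarrow> complex) \<Rightarrow> 'a \<Rightarrow> real" where
  "cesaro_weight \<omega> \<mu> \<phi> z =
     \<mu> (norm z) * cmod (radial_deriv \<phi> z) * integral {0..norm z} (\<lambda>t. 1 / \<omega> t)"

end

theory Submission
  imports Defs "HOL-Complex_Analysis.Complex_Analysis"
begin

text \<open>The identity \<open>\<R>(T\<^sub>\<phi> f) = f \<R>\<phi>\<close> turns the operator into multiplication by \<open>\<R>\<phi>\<close>.
  For the upper bound, integrating \<open>\<R>f\<close> along radii gives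
  \<open>|f z - f 0| \<le> K B \<integral>\<^sub>0\<^bsup>\<parallel>z\<parallel>\<^esup> 1/\<omega>\<close> whenever \<open>\<omega> |\<R>f| \<le> B\<close>; the maximum principle on slices controls the
  region near the origin, both here and for \<open>\<mu> |\<R>\<phi>|\<close>.
  For the lower bound, given a point \<open>z\<close> take a norming functional \<open>l\<close> and a lacunary polynomial
  \<open>g\<close> with nonnegative coefficients that is comparable to \<open>1/\<omega>\<close> on \<open>[0, \<parallel>z\<parallel>]\<close> and dominated by it
  on \<open>[0,1)\<close>: the primitive of \<open>g\<close> composed with \<open>l\<close> is a test function of bounded norm whose value
  at \<open>z\<close> is comparable to \<open>\<integral>\<^sub>0\<^bsup>\<parallel>z\<parallel>\<^esup> 1/\<omega>\<close>.\<close>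

subsection \<open>Holomorphic functions on the unit ball\<close>

text \<open>Holomorphy means Frechet differentiability at each point with a complex linear
  derivative; nothing is assumed about how the derivative varies. Yet the operator contains a
  derivative of \<phi>, and its result must be differentiated again. The way out: the radial
  derivative at x is the derivative of u \<mapsto> f(u x) at u = 1, so Cauchy's formula on a circle
  in u expresses it through point values of f alone. That integral and the one defining the operator
  are both differentiated under the integral sign, once Cauchy estimates on complex lines have made
  the derivative norm continuous. The origin needs care because both given quantities degenerate
  there: the radial derivative Df(z) z vanishes at 0, and so does the integral of 1/\<omega>.
  Neither bound says anything directly about Df, or about \<mu> times the radial derivative of
  \<phi>, near 0. The lacunary sums are finite, cut off at an index that depends on
  \<open>norm z\<close>, so no series has to be summed on the ball. What matters is that the two
  comparison constants depend neither on z nor on the cutoff.\<close>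

lemma bounded_bilinear_scaleC:
  "bounded_bilinear (scaleC :: complex \<Rightarrow> 'a::complex_banach \<Rightarrow> 'a)"
proof
  show "(c + d) *\<^sub>C x = c *\<^sub>C x + d *\<^sub>C x" for c d and x :: 'a
    by (rule scaleC_add_left)
  show "c *\<^sub>C (x + y) = c *\<^sub>C x + c *\<^sub>C y" for c and x y :: 'a
    by (rule scaleC_add_right)
  show "(r *\<^sub>R c) *\<^sub>C x = r *\<^sub>R (c *\<^sub>C x)" for r c and x :: 'a
    by (simp add: scaleR_conv_of_real flip: scaleC_of_real scaleC_scaleC)
  show "c *\<^sub>C (r *\<^sub>R x) = r *\<^sub>R (c *\<^sub>C x)" for r c and x :: 'a
    by (simp add: scaleC_scaleC mult.commute flip: scaleC_of_real)
  show "\<exists>K. \<forall>c (x::'a). norm (c *\<^sub>C x) \<le> norm c * norm x * K"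
    by (intro exI[of _ 1]) (simp add: norm_scaleC)
qed

interpretation scaleC: bounded_bilinear "scaleC :: complex \<Rightarrow> 'a::complex_banach \<Rightarrow> 'a"
  by (rule bounded_bilinear_scaleC)

lemma scaleC_one [simp]: "1 *\<^sub>C x = (x :: 'a::complex_banach)"
  using scaleC_of_real[of 1 x] by simp

text \<open>The packaging as a bounded operator gives z \<mapsto> Df(z) values in a normed space, so
  that its continuity in the operator norm can be stated; differentiation under the integral relies
  on it.\<close>

definition fderiv :: "('a::complex_banach \<Rightarrow> complex) \<Rightarrow> 'a \<Rightarrow> 'a \<Rightarrow>\<^sub>L complex" where
  "fderiv f z = Blinfun (frechet_derivative f (at z))"

lemma fderiv_eqI:
  assumes "(f has_derivative D) (at z)"
  shows "blinfun_apply (fderiv f z) = D"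
  using assms frechet_derivative_at[OF assms]
  by (simp add: fderiv_def bounded_linear_Blinfun_apply has_derivative_bounded_linear)

lemma radial_deriv_eqI:
  assumes "(f has_derivative D) (at z)"
  shows "radial_deriv f z = D z"
  using frechet_derivative_at[OF assms] by (simp add: radial_deriv_def)

context
  fixes f :: "'a::complex_banach \<Rightarrow> complex"
  assumes f: "f \<in> holomorphic_ball"
begin

lemma has_derivative_fderiv:
  assumes "z \<in> ball 0 1"
  shows "(f has_derivative blinfun_apply (fderiv f z)) (at z)"
proof -
  from f assms obtain D where "(f has_derivative D) (at z)"
    unfolding holomorphic_ball_def by blast
  then show ?thesis by (simp add: fderiv_eqI)
qed

lemma fderiv_scaleC:
  assumes "z \<in> ball 0 1"
  shows "fderiv f z (c *\<^sub>C x) = c * fderiv f z x"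
proof -
  from f assms obtain D where "(f has_derivative D) (at z)" "\<forall>c x. D (c *\<^sub>C x) = c * D x"
    unfolding holomorphic_ball_def by blast
  then show ?thesis by (simp add: fderiv_eqI)
qed

lemma radial_deriv_fderiv:
  assumes "z \<in> ball 0 1"
  shows "radial_deriv f z = fderiv f z z"
  using radial_deriv_eqI[OF has_derivative_fderiv[OF assms]] .

lemma continuous_on_holomorphic_ball: "continuous_on (ball 0 1) f"
  by (intro continuous_at_imp_continuous_on ballI has_derivative_continuous[OF has_derivative_fderiv])

text \<open>Complex linearity of Df turns the real chain rule along a complex line into a complex
  derivative. Through this lemma one-variable theory (Cauchy estimates, Cauchy's formula, maximum
  principle) reaches functions on the ball.\<close>

lemma DERIV_holomorphic_line:
  assumes "z + c *\<^sub>C h \<in> ball 0 1"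
  shows "((\<lambda>c. f (z + c *\<^sub>C h)) has_field_derivative fderiv f (z + c *\<^sub>C h) h) (at c)"
proof -
  have *: "((\<lambda>c. z + c *\<^sub>C h) has_derivative (\<lambda>d. d *\<^sub>C h)) (at c)"
    by (intro has_derivative_add[OF has_derivative_const, simplified]
        bounded_linear_imp_has_derivative scaleC.bounded_linear_left)
  have "((\<lambda>c. f (z + c *\<^sub>C h)) has_derivative (\<lambda>d. fderiv f (z + c *\<^sub>C h) (d *\<^sub>C h))) (at c)"
    by (rule has_derivative_compose[OF * has_derivative_fderiv[OF assms]])
  then show ?thesis
    by (simp add: has_field_derivative_def fderiv_scaleC[OF assms] mult_commute_abs)
qed

end

section \<open>Cauchy estimates and norm continuity of the derivative\<close>

lemma Cauchy_bound_at_0: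
  fixes p :: "complex \<Rightarrow> complex"
  assumes p: "\<And>c. cmod c \<le> \<rho> \<Longrightarrow> (p has_field_derivative p' c) (at c)"
    and B: "\<And>c. cmod c \<le> \<rho> \<Longrightarrow> cmod (p c) \<le> B" and "0 < \<rho>"
  shows "cmod (p' 0) \<le> B / \<rho>"
proof -
  have "cmod ((deriv ^^ 1) p 0) \<le> fact 1 * B / \<rho> ^ 1"
  proof (rule Cauchy_inequality)
    show "p holomorphic_on ball 0 \<rho>"
      by (rule holomorphic_onI, rule field_differentiable_at_within)
        (use p in \<open>force simp: field_differentiable_def\<close>)
    show "continuous_on (cball 0 \<rho>) p"
      by (rule continuous_at_imp_continuous_on) (use p in \<open>force intro: DERIV_isCont\<close>)
  qed (use B \<open>0 < \<rho>\<close> in auto)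
  moreover have "deriv p 0 = p' 0"
    using p[of 0] \<open>0 < \<rho>\<close> by (simp add: DERIV_imp_deriv)
  ultimately show ?thesis by simp
qed

text \<open>The slice c \<mapsto> f(z + c h) stays in the ball of radius r around z for |c| \<le> r
  / \<open>norm h\<close>; the one-variable Cauchy estimate on that disc gives the factor
  \<open>norm h\<close>.\<close>

lemma fderiv_bound:
  fixes f :: "'a::complex_banach \<Rightarrow> complex"
  assumes f: "f \<in> holomorphic_ball" and sub: "cball z r \<subseteq> ball 0 1" and "0 < r"
    and M: "\<And>w. w \<in> cball z r \<Longrightarrow> cmod (f w) \<le> M"
  shows "cmod (fderiv f z h) \<le> M / r * norm h"
proof (cases "h = 0")
  case False
  have in_cball: "z + c *\<^sub>C h \<in> cball z r" if "cmod c \<le> r / norm h" for c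
    using that False by (simp add: dist_norm norm_scaleC field_simps)
  have "cmod (fderiv f (z + 0 *\<^sub>C h) h) \<le> M / (r / norm h)"
    using False \<open>0 < r\<close> in_cball sub
    by (intro Cauchy_bound_at_0[where p = "\<lambda>c. f (z + c *\<^sub>C h)"] DERIV_holomorphic_line[OF f] M
        subsetD[OF sub]) simp_all
  then show ?thesis by (simp add: scaleC.zero_left)
qed (simp add: blinfun.zero_right)

text \<open>Cauchy estimates are used twice. Continuity bounds f by M on the ball of radius 3r; a
  first estimate then bounds Df by M/r on the ball of radius 2r, so f is Lipschitz there. A second
  estimate, for the difference c \<mapsto> f(w + c k) - f(z + c k) with w within r of z, bounds
  Df(w) - Df(z) by a multiple of \<open>norm (w - z)\<close>.\<close>

lemma isCont_fderiv:
  fixes f :: "'a::complex_banach \<Rightarrow> complex"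
  assumes f: "f \<in> holomorphic_ball" and z: "z \<in> ball 0 1"
  shows "isCont (fderiv f) z"
proof -
  have "isCont f z"
    by (rule has_derivative_continuous[OF has_derivative_fderiv[OF f z]])
  then obtain d where "0 < d" and d: "\<And>w. dist w z < d \<Longrightarrow> dist (f w) (f z) < 1"
    unfolding continuous_at_eps_delta by (meson zero_less_one)
  obtain e where "0 < e" and e: "ball z e \<subseteq> ball 0 1"
    using z open_ball open_contains_ball by blast
  define r where "r = min d e / 4"
  have r: "0 < r" "3 * r < d" "3 * r < e"
    using \<open>0 < d\<close> \<open>0 < e\<close> by (auto simp: r_def)
  have sub: "cball z (3 * r) \<subseteq> ball 0 1"
    using e r by (auto simp: subset_iff)
  define M where "M = cmod (f z) + 1"
  have "0 < M" by (simp add: M_def add_nonneg_pos)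
  have M: "cmod (f w) \<le> M" if "w \<in> cball z (3 * r)" for w
  proof -
    have "cmod (f w - f z) < 1"
      using d[of w] that r by (simp add: dist_commute dist_norm)
    then show ?thesis
      unfolding M_def using norm_triangle_ineq2[of "f w" "f z"] by linarith
  qed
  have step: "cball x r \<subseteq> cball z (3 * r)" if "x \<in> cball z (2 * r)" for x
  proof
    fix y assume "y \<in> cball x r"
    then show "y \<in> cball z (3 * r)" using that dist_triangle[of z y x] by simp
  qed
  have bd: "cmod (fderiv f x h) \<le> M / r * norm h" if "x \<in> cball z (2 * r)" for x h
    using step[OF that] sub M r by (intro fderiv_bound[OF f]) auto
  have sub2: "cball z (2 * r) \<subseteq> ball 0 1"
    using sub r by (auto simp: subset_iff)
  have lip: "cmod (f x - f y) \<le> M / r * norm (x - y)"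
    if xy: "x \<in> cball z (2 * r)" "y \<in> cball z (2 * r)" for x y
  proof (rule differentiable_bound[OF convex_cball _ _ xy])
    fix x assume x: "x \<in> cball z (2 * r)"
    show "(f has_derivative fderiv f x) (at x within cball z (2 * r))"
      by (rule has_derivative_at_withinI[OF has_derivative_fderiv[OF f subsetD[OF sub2 x]]])
    show "onorm (fderiv f x) \<le> M / r"
      by (rule onorm_bound[OF _ bd[OF x]]) (use \<open>0 < M\<close> r in simp)
  qed
  have est: "norm (fderiv f w - fderiv f z) \<le> M / r / r * norm (w - z)" if w: "w \<in> cball z r" for w
  proof (rule norm_blinfun_bound)
    fix k
    show "norm ((fderiv f w - fderiv f z) k) \<le> M / r / r * norm (w - z) * norm k"
    proof (cases "k = 0")
      case False
      have inb: "w + c *\<^sub>C k \<in> cball z (2 * r)" "z + c *\<^sub>C k \<in> cball z (2 * r)"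
        if "cmod c \<le> r / norm k" for c
      proof -
        have *: "norm (c *\<^sub>C k) \<le> r"
          using that False by (simp add: norm_scaleC field_simps)
        have "norm (z - w) \<le> r" using w by (simp add: dist_norm)
        then have "norm (z - (w + c *\<^sub>C k)) \<le> 2 * r"
          using * norm_triangle_ineq4[of "z - w" "c *\<^sub>C k"] by (simp add: diff_diff_eq)
        then show "w + c *\<^sub>C k \<in> cball z (2 * r)" by (simp add: dist_norm)
        show "z + c *\<^sub>C k \<in> cball z (2 * r)" using * r by (simp add: dist_norm)
      qed
      have "cmod (fderiv f (w + 0 *\<^sub>C k) k - fderiv f (z + 0 *\<^sub>C k) k)
          \<le> (M / r * norm (w - z)) / (r / norm k)"
      proof (rule Cauchy_bound_at_0[where p = "\<lambda>c. f (w + c *\<^sub>C k) - f (z + c *\<^sub>C k)"])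
        fix c assume c: "cmod c \<le> r / norm k"
        show "((\<lambda>c. f (w + c *\<^sub>C k) - f (z + c *\<^sub>C k)) has_field_derivative
            fderiv f (w + c *\<^sub>C k) k - fderiv f (z + c *\<^sub>C k) k) (at c)"
          by (intro DERIV_diff DERIV_holomorphic_line[OF f] subsetD[OF sub2] inb[OF c])
        show "cmod (f (w + c *\<^sub>C k) - f (z + c *\<^sub>C k)) \<le> M / r * norm (w - z)"
          using lip[OF inb[OF c]] by simp
      qed (use False r in auto)
      then show ?thesis
        by (simp add: scaleC.zero_left blinfun.diff_left)
    qed (simp add: blinfun.zero_right)
  qed (use \<open>0 < M\<close> r in auto)
  have "((\<lambda>w. fderiv f w - fderiv f z) \<longlongrightarrow> 0) (at z)"
  proof (rule Lim_null_comparison)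
    show "\<forall>\<^sub>F w in at z. norm (fderiv f w - fderiv f z) \<le> M / r / r * norm (w - z)"
      unfolding eventually_at
      by (rule exI[of _ r]) (use est r in \<open>auto simp: dist_commute\<close>)
    show "((\<lambda>w. M / r / r * norm (w - z)) \<longlongrightarrow> 0) (at z)"
      by (rule tendsto_eq_intros tendsto_const refl)+ simp
  qed
  then show ?thesis
    by (simp add: isCont_def LIM_zero_iff)
qed

lemma continuous_on_fderiv:
  assumes "f \<in> holomorphic_ball" shows "continuous_on (ball 0 1) (fderiv f)"
  using isCont_fderiv[OF assms] continuous_at_imp_continuous_on by blast

section \<open>Differentiation under an integral along a curve of dilations\<close>

lemma has_vector_derivative_holomorphic_line:
  fixes f :: "'a::complex_banach \<Rightarrow> complex"
  assumes f: "f \<in> holomorphic_ball" and z: "z + t *\<^sub>R h \<in> ball 0 1"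
  shows "((\<lambda>t. f (z + t *\<^sub>R h)) has_vector_derivative fderiv f (z + t *\<^sub>R h) h) (at t within S)"
proof -
  have *: "((\<lambda>t. z + t *\<^sub>R h) has_derivative (\<lambda>d. d *\<^sub>R h)) (at t within S)"
    by (intro has_derivative_add[OF has_derivative_const, simplified]
        bounded_linear_imp_has_derivative bounded_linear_scaleR_left)
  have "((\<lambda>t. f (z + t *\<^sub>R h)) has_derivative (\<lambda>d. fderiv f (z + t *\<^sub>R h) (d *\<^sub>R h))) (at t within S)"
    by (rule has_derivative_compose[OF * has_derivative_fderiv[OF f z]])
  then show ?thesis
    by (simp add: has_vector_derivative_def blinfun.scaleR_right)
qed

text \<open>Shaped to serve two integrals: the Cauchy integral, where c runs over a circle around 1,
  and the radial integral, where c t = t. The kernel k enters only through its derivative and its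
  integrability, which leaves room for a removable singularity in t.\<close>

lemma has_derivative_parameter_integral:
  fixes g :: "'a::complex_banach \<Rightarrow> complex" and k :: "'a \<Rightarrow> real \<Rightarrow> complex"
  assumes g: "g \<in> holomorphic_ball" and U: "convex U" "open U" "x \<in> U"
    and c: "continuous_on {a..b} c" and n: "continuous_on {a..b} n"
    and sub: "\<And>x t. x \<in> U \<Longrightarrow> t \<in> {a..b} \<Longrightarrow> c t *\<^sub>C x \<in> ball 0 1"
    and k: "\<And>x t. x \<in> U \<Longrightarrow> t \<in> {a..b} \<Longrightarrow>
      ((\<lambda>x. k x t) has_derivative (\<lambda>h. n t * fderiv g (c t *\<^sub>C x) h)) (at x)"
    and int: "\<And>x. x \<in> U \<Longrightarrow> k x integrable_on {a..b}"
  shows "((\<lambda>x. integral {a..b} (k x)) has_derivative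
      (\<lambda>h. integral {a..b} (\<lambda>t. n t * fderiv g (c t *\<^sub>C x) h))) (at x)"
proof -
  \<comment> \<open>The derivative of the kernel as an operator, the form in which the Leibniz rule
    asks for joint continuity in x and t.\<close>
  define K where "K = (\<lambda>x t. blinfun_mult_right (n t) o\<^sub>L fderiv g (c t *\<^sub>C x))"
  have Kap: "blinfun_apply (K x t) = (\<lambda>h. n t * fderiv g (c t *\<^sub>C x) h)" for x t
    by (simp add: K_def fun_eq_iff)
  have contK: "continuous_on (U \<times> cbox a b) (\<lambda>(x, t). K x t)"
  proof -
    have c': "continuous_on (U \<times> {a..b}) (\<lambda>p. c (snd p))"
      and n': "continuous_on (U \<times> {a..b}) (\<lambda>p. n (snd p))"
      by (auto intro!: continuous_on_compose2[OF c] continuous_on_compose2[OF n] continuous_intros)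
    have "continuous_on (U \<times> {a..b}) (\<lambda>p. c (snd p) *\<^sub>C fst p)"
      by (intro scaleC.continuous_on c' continuous_intros)
    then have "continuous_on (U \<times> {a..b}) (\<lambda>p. fderiv g (c (snd p) *\<^sub>C fst p))"
      by (rule continuous_on_compose2[OF continuous_on_fderiv[OF g]]) (use sub in force)
    then have "continuous_on (U \<times> {a..b}) (\<lambda>p. K (fst p) (snd p))"
      unfolding K_def
      by (intro bounded_bilinear.continuous_on[OF bounded_bilinear_blinfun_compose]
          bounded_linear.continuous_on[OF bounded_linear_blinfun_mult_right] n')
    then show ?thesis by (simp add: case_prod_unfold)
  qed
  have "((\<lambda>x. integral (cbox a b) (k x)) has_derivative blinfun_apply (integral (cbox a b) (K x)))
      (at x within U)"
  proof (rule leibniz_rule[OF _ _ contK \<open>x \<in> U\<close> \<open>convex U\<close>])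
    show "((\<lambda>x. k x t) has_derivative blinfun_apply (K x t)) (at x within U)"
      if "x \<in> U" "t \<in> cbox a b" for x t
      using has_derivative_at_withinI[OF k] that by (simp add: Kap)
    show "k x integrable_on cbox a b" if "x \<in> U" for x
      using int[OF that] by simp
  qed
  then have "((\<lambda>x. integral {a..b} (k x)) has_derivative blinfun_apply (integral {a..b} (K x))) (at x)"
    using at_within_open[OF U(3,2)] by simp
  moreover have "blinfun_apply (integral {a..b} (K x)) =
      (\<lambda>h. integral {a..b} (\<lambda>t. n t * fderiv g (c t *\<^sub>C x) h))"
  proof -
    have "continuous_on {a..b} (\<lambda>t. (\<lambda>(x, t). K x t) (x, t))"
      by (rule continuous_on_compose2[OF contK]) (use \<open>x \<in> U\<close> in \<open>auto intro!: continuous_intros\<close>)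
    then have "K x integrable_on {a..b}"
      by (simp add: integrable_continuous_interval)
    from blinfun_apply_integral[OF this] show ?thesis by (simp add: fun_eq_iff Kap)
  qed
  ultimately show ?thesis by simp
qed

section \<open>Holomorphy of the radial derivative\<close>

lemma radial_deriv_0 [simp]: "f \<in> holomorphic_ball \<Longrightarrow> radial_deriv f 0 = 0"
  by (simp add: radial_deriv_fderiv blinfun.zero_right)

text \<open>This is Cauchy's formula for the derivative of u \<mapsto> f(u x) at u = 1. On the
  circle c(t) the differential is 2 \<pi> i (c(t) - 1) dt, which cancels the prefactor and one of
  the two powers of c(t) - 1. The condition on \<rho> keeps u x in the ball for u in the closed
  disc.\<close>

lemma radial_deriv_Cauchy:
  fixes f :: "'a::complex_banach \<Rightarrow> complex"
  assumes f: "f \<in> holomorphic_ball" and \<rho>: "0 < \<rho>" "(1 + \<rho>) * norm x < 1"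
  shows "radial_deriv f x =
    integral {0..1} (\<lambda>t. f (circlepath 1 \<rho> t *\<^sub>C x) / (circlepath 1 \<rho> t - 1))"
proof -
  have in_ball: "0 + u *\<^sub>C x \<in> ball 0 1" if "u \<in> cball 1 \<rho>" for u
  proof -
    have "cmod u \<le> 1 + \<rho>"
      using that norm_triangle_ineq2[of u 1] by (simp add: dist_norm norm_minus_commute)
    then have "norm (u *\<^sub>C x) \<le> (1 + \<rho>) * norm x"
      by (simp add: norm_scaleC mult_right_mono)
    with \<rho> show ?thesis by simp
  qed
  have D: "((\<lambda>u. f (0 + u *\<^sub>C x)) has_field_derivative fderiv f (0 + u *\<^sub>C x) x) (at u)"
    if "u \<in> cball 1 \<rho>" for u
    by (rule DERIV_holomorphic_line[OF f in_ball[OF that]])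
  define p where "p = (\<lambda>u. f (u *\<^sub>C x))"
  have p: "(p has_field_derivative fderiv f (u *\<^sub>C x) x) (at u)" if "u \<in> cball 1 \<rho>" for u
    using D[OF that] by (simp add: p_def)
  have cont: "continuous_on (cball 1 \<rho>) p"
    by (rule continuous_at_imp_continuous_on) (use p in \<open>force intro: DERIV_isCont\<close>)
  have hol: "p holomorphic_on ball 1 \<rho>"
    by (rule holomorphic_onI, rule field_differentiable_at_within)
      (use p in \<open>force simp: field_differentiable_def\<close>)
  have one: "1 \<in> cball 1 \<rho>" "1 \<in> ball 1 \<rho>" using \<rho> by auto
  have "radial_deriv f x = fderiv f x x"
    using in_ball[OF one(1)] by (intro radial_deriv_fderiv[OF f]) simp
  also have "\<dots> = deriv p 1"
    using DERIV_imp_deriv[OF p[OF one(1)]] by simp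
  also have "\<dots> = contour_integral (circlepath 1 \<rho>) (\<lambda>u. p u / (u - 1)\<^sup>2) / (2 * of_real pi * \<i>)"
    using Cauchy_contour_integral_circlepath_2[OF cont hol one(2)] by simp
  also have "\<dots> = integral {0..1} (\<lambda>t. p (circlepath 1 \<rho> t) / (circlepath 1 \<rho> t - 1)\<^sup>2 *
      (2 * pi * \<i> * \<rho> * exp (2 * of_real pi * \<i> * t))) / (2 * of_real pi * \<i>)"
    unfolding contour_integral_integral
    by (intro arg_cong2[where f = "(/)"] refl integral_cong) (simp add: vector_derivative_circlepath)
  also have "\<dots> = integral {0..1} (\<lambda>t. p (circlepath 1 \<rho> t) / (circlepath 1 \<rho> t - 1)\<^sup>2 *
      (2 * pi * \<i> * \<rho> * exp (2 * of_real pi * \<i> * t)) / (2 * of_real pi * \<i>))"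
    by (rule Henstock_Kurzweil_Integration.integral_divide[symmetric])
  also have "\<dots> = integral {0..1} (\<lambda>t. f (circlepath 1 \<rho> t *\<^sub>C x) / (circlepath 1 \<rho> t - 1))"
    by (rule integral_cong) (simp add: p_def circlepath power2_eq_square)
  finally show ?thesis .
qed

lemma radial_deriv_differentiable:
  fixes f :: "'a::complex_banach \<Rightarrow> complex"
  assumes f: "f \<in> holomorphic_ball" and z: "z \<in> ball 0 1"
  obtains D where "(radial_deriv f has_derivative D) (at z)" "\<And>c h. D (c *\<^sub>C h) = c * D h"
proof -
  obtain r where r: "norm z < r" "r < 1" using z dense by auto
  then have "0 < r" by (meson norm_ge_zero le_less_trans)
  \<comment> \<open>With this radius (1 + \<rho>) r = 1 - \<rho>^2, so a single circle serves all x
    in the ball of radius r, a neighbourhood of z.\<close>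
  define \<rho> where "\<rho> = 1 - r"
  have "0 < \<rho>" using r by (simp add: \<rho>_def)
  have "(1 + \<rho>) * r < 1"
  proof -
    have "(1 + \<rho>) * r = 1 - \<rho>\<^sup>2" by (simp add: \<rho>_def power2_eq_square algebra_simps)
    then show ?thesis using \<open>0 < \<rho>\<close> by simp
  qed
  have small: "(1 + \<rho>) * norm x < 1" if "x \<in> ball 0 r" for x :: 'a
  proof -
    have "(1 + \<rho>) * norm x \<le> (1 + \<rho>) * r" using that \<open>0 < \<rho>\<close> by (intro mult_left_mono) auto
    with \<open>(1 + \<rho>) * r < 1\<close> show ?thesis by simp
  qed
  define c where "c = circlepath 1 \<rho>"
  \<comment> \<open>The numerator comes from the chain rule and complex linearity: Df(c x)(c h) = c
    Df(c x) h.\<close>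
  define n where "n = (\<lambda>t. c t / (c t - 1))"
  have c1: "c t - 1 \<noteq> 0" for t using \<open>0 < \<rho>\<close> by (simp add: c_def circlepath)
  have cc: "continuous_on {0..1} c"
    using path_circlepath unfolding c_def path_def by blast
  have cn: "continuous_on {0..1} n"
    unfolding n_def using c1 by (intro continuous_intros cc) auto
  have sub: "c t *\<^sub>C x \<in> ball 0 1" if "x \<in> ball 0 r" for x :: 'a and t
  proof -
    have "cmod (c t) \<le> 1 + \<rho>"
      unfolding c_def circlepath
      by (rule order_trans[OF norm_triangle_ineq]) (use \<open>0 < \<rho>\<close> in \<open>simp add: norm_mult\<close>)
    then have "norm (c t *\<^sub>C x) \<le> (1 + \<rho>) * norm x"
      by (simp add: norm_scaleC mult_right_mono)
    with small[OF that] show ?thesis by simp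
  qed
  define k where "k = (\<lambda>x t. f (c t *\<^sub>C x) / (c t - 1))"
  have "((\<lambda>x. integral {0..1} (k x)) has_derivative
      (\<lambda>h. integral {0..1} (\<lambda>t. n t * fderiv f (c t *\<^sub>C z) h))) (at z)"
  proof (rule has_derivative_parameter_integral[OF f convex_ball open_ball _ cc cn sub])
    show "z \<in> ball 0 r" using r by simp
    fix x :: 'a assume x: "x \<in> ball 0 r"
    show "((\<lambda>x. k x t) has_derivative (\<lambda>h. n t * fderiv f (c t *\<^sub>C x) h)) (at x)" for t
    proof -
      have *: "((\<lambda>x. c t *\<^sub>C x) has_derivative (\<lambda>h. c t *\<^sub>C h)) (at x)"
        by (rule bounded_linear_imp_has_derivative[OF scaleC.bounded_linear_right])
      have "((\<lambda>x. f (c t *\<^sub>C x)) has_derivative (\<lambda>h. fderiv f (c t *\<^sub>C x) (c t *\<^sub>C h))) (at x)"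
        by (rule has_derivative_compose[OF * has_derivative_fderiv[OF f sub[OF x]]])
      then have "((\<lambda>x. f (c t *\<^sub>C x) * inverse (c t - 1)) has_derivative
          (\<lambda>h. fderiv f (c t *\<^sub>C x) (c t *\<^sub>C h) * inverse (c t - 1))) (at x)"
        by (rule has_derivative_mult_left)
      then show ?thesis
        by (simp add: k_def n_def divide_inverse fderiv_scaleC[OF f sub[OF x]] mult_ac)
    qed
    have "continuous_on {0..1} (\<lambda>t. f (c t *\<^sub>C x))"
      by (rule continuous_on_compose2[OF continuous_on_holomorphic_ball[OF f]])
        (use sub[OF x] in \<open>auto intro!: scaleC.continuous_on cc continuous_intros\<close>)
    then show "k x integrable_on {0..1}"
      unfolding k_def using c1
      by (intro integrable_continuous_interval continuous_intros cc) auto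
  qed
  then have "(radial_deriv f has_derivative
      (\<lambda>h. integral {0..1} (\<lambda>t. n t * fderiv f (c t *\<^sub>C z) h))) (at z)"
    by (rule has_derivative_transform_within_open[where s = "ball 0 r"])
      (use r radial_deriv_Cauchy[OF f \<open>0 < \<rho>\<close> small] in \<open>auto simp: k_def c_def\<close>)
  moreover have "integral {0..1} (\<lambda>t. n t * fderiv f (c t *\<^sub>C z) (u *\<^sub>C h)) =
      u * integral {0..1} (\<lambda>t. n t * fderiv f (c t *\<^sub>C z) h)" for u h
  proof -
    have "n t * fderiv f (c t *\<^sub>C z) (u *\<^sub>C h) = u * (n t * fderiv f (c t *\<^sub>C z) h)" for t
      using sub[of z t] r by (simp add: fderiv_scaleC[OF f])
    then show ?thesis
      by (simp only: Henstock_Kurzweil_Integration.integral_mult_right)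
  qed
  ultimately show ?thesis by (rule that)
qed

text \<open>The product is the integrand of the operator without the factor 1/t. The zero extension
  is supplied by f, whatever value \<open>radial_deriv \<phi>\<close> takes outside the
  ball.\<close>

lemma mult_radial_deriv_holomorphic:
  fixes f \<phi> :: "'a::complex_banach \<Rightarrow> complex"
  assumes f: "f \<in> holomorphic_ball" and \<phi>: "\<phi> \<in> holomorphic_ball"
  shows "(\<lambda>z. f z * radial_deriv \<phi> z) \<in> holomorphic_ball"
  unfolding holomorphic_ball_def
proof (intro CollectI conjI ballI allI impI)
  fix z :: 'a assume z: "z \<in> ball 0 1"
  obtain D where D: "(radial_deriv \<phi> has_derivative D) (at z)" "\<And>c h. D (c *\<^sub>C h) = c * D h"
    using radial_deriv_differentiable[OF \<phi> z] by blast
  have "((\<lambda>z. f z * radial_deriv \<phi> z) has_derivative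
      (\<lambda>h. f z * D h + fderiv f z h * radial_deriv \<phi> z)) (at z)"
    by (rule has_derivative_mult[OF has_derivative_fderiv[OF f z] D(1)])
  then show "\<exists>D. ((\<lambda>z. f z * radial_deriv \<phi> z) has_derivative D) (at z) \<and>
      (\<forall>c x. D (c *\<^sub>C x) = c * D x)"
    by (intro exI conjI) (assumption, simp add: D(2) fderiv_scaleC[OF f z] algebra_simps)
next
  fix z :: 'a assume "z \<notin> ball 0 1"
  then have "f z = 0" using f by (simp add: holomorphic_ball_def)
  then show "f z * radial_deriv \<phi> z = 0" by simp
qed

section \<open>Radial antiderivatives: inverting the radial derivative on functions vanishing at
  0\<close>

context
  fixes g :: "'a::complex_banach \<Rightarrow> complex"
  assumes g: "g \<in> holomorphic_ball" and g0: "g 0 = 0"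
begin

text \<open>Because g(0) = 0, the quotient g(t z)/t is a difference quotient at t = 0 with limit
  Dg(0) z, so the singularity is removable.\<close>

lemma radial_quotient_continuous:
  assumes z: "z \<in> ball 0 1"
  shows "continuous_on {0..1}
    (\<lambda>t::real. if t = 0 then fderiv g 0 z else g (t *\<^sub>R z) * complex_of_real (1 / t))"
proof -
  \<comment> \<open>The parameter is made complex so that the slice derivative at 0 gives the limit;
    the claim is the restriction of q to [0,1].\<close>
  define q where "q = (\<lambda>u. if u = 0 then fderiv g 0 z else g (u *\<^sub>C z) / u)"
  have D: "((\<lambda>u. g (0 + u *\<^sub>C z)) has_field_derivative fderiv g (0 + u *\<^sub>C z) z) (at u)"
    if "cmod u \<le> 1" for u
  proof (rule DERIV_holomorphic_line[OF g])
    have "cmod u * norm z \<le> 1 * norm z" using that by (intro mult_right_mono) auto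
    then show "0 + u *\<^sub>C z \<in> ball 0 1" using z by (simp add: norm_scaleC)
  qed
  have "isCont q u" if u: "cmod u \<le> 1" for u
  proof (cases "u = 0")
    case True
    have "((\<lambda>h. g (h *\<^sub>C z) / h) \<longlongrightarrow> fderiv g 0 z) (at 0)"
      using D[of 0] g0 by (simp add: DERIV_def scaleC.zero_left)
    then have "(q \<longlongrightarrow> fderiv g 0 z) (at 0)"
      by (rule Lim_transform_eventually) (auto simp: eventually_at q_def intro: exI[of _ 1])
    moreover have "q 0 = fderiv g 0 z" by (simp add: q_def)
    ultimately show ?thesis using True by (simp add: isCont_def)
  next
    case False
    have "isCont (\<lambda>u. g (u *\<^sub>C z) / u) u"
      using DERIV_isCont[OF D[OF u]] False by (intro continuous_intros) simp_all
    moreover have "\<forall>\<^sub>F v in nhds u. q v = g (v *\<^sub>C z) / v"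
      using t1_space_nhds[OF False] by (rule eventually_mono) (simp add: q_def)
    ultimately show ?thesis by (simp add: isCont_cong)
  qed
  then have "continuous_on (cball 0 1) q"
    by (intro continuous_at_imp_continuous_on) simp
  then have "continuous_on {0..1} (\<lambda>t. q (complex_of_real t))"
    by (rule continuous_on_compose2) (auto intro!: continuous_intros)
  then show ?thesis
    by (simp add: q_def scaleC_of_real divide_inverse cong: if_cong)
qed

text \<open>By the convention 1 / 0 = 0 the left integrand is 0 at t = 0; it can differ from the
  continuous extension only on a null set.\<close>

lemma radial_quotient_integral_eq:
  "integral {0..1} (\<lambda>t. g (t *\<^sub>R z) * complex_of_real (1 / t)) =
   integral {0..1} (\<lambda>t. if t = 0 then fderiv g 0 z else g (t *\<^sub>R z) * complex_of_real (1 / t))"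
  by (rule integral_spike[of "{0}"]) auto

lemma radial_quotient_integrable:
  assumes "z \<in> ball 0 1"
  shows "(\<lambda>t. g (t *\<^sub>R z) * complex_of_real (1 / t)) integrable_on {0..1}"
  by (rule integrable_spike[OF integrable_continuous_interval[OF radial_quotient_continuous[OF assms]],
        of "{0}"]) auto

text \<open>The chain rule on g(t x) produces a factor t that cancels 1/t. At t = 0 the continuous
  extension x \<mapsto> Dg(0) x is linear and hence its own derivative, so the same formula Dg(t x)
  h holds for all t in [0,1].\<close>

lemma has_derivative_radial_antiderivative:
  assumes z: "z \<in> ball 0 1"
  shows "((\<lambda>z. integral {0..1} (\<lambda>t. g (t *\<^sub>R z) * complex_of_real (1 / t))) has_derivative
    (\<lambda>h. integral {0..1} (\<lambda>t. fderiv g (t *\<^sub>R z) h))) (at z)"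
proof -
  have sub: "complex_of_real t *\<^sub>C x \<in> ball 0 1" if "x \<in> ball 0 1" "t \<in> {0..1}" for x :: 'a and t
    using that mult_right_mono[of t 1 "norm x"] by (simp add: scaleC_of_real)
  define k where "k = (\<lambda>x (t::real). if t = 0 then fderiv g 0 x else g (t *\<^sub>R x) * complex_of_real (1 / t))"
  have "((\<lambda>x. integral {0..1} (k x)) has_derivative
      (\<lambda>h. integral {0..1} (\<lambda>t. 1 * fderiv g (complex_of_real t *\<^sub>C z) h))) (at z)"
  proof (rule has_derivative_parameter_integral[OF g convex_ball open_ball z])
    fix x :: 'a assume x: "x \<in> ball 0 1"
    show "k x integrable_on {0..1}"
      unfolding k_def by (rule integrable_continuous_interval[OF radial_quotient_continuous[OF x]])
    fix t :: real assume t: "t \<in> {0..1}"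
    show "((\<lambda>x. k x t) has_derivative (\<lambda>h. 1 * fderiv g (complex_of_real t *\<^sub>C x) h)) (at x)"
    proof (cases "t = 0")
      case True
      then show ?thesis
        by (simp add: k_def scaleC.zero_left bounded_linear_imp_has_derivative
            blinfun.bounded_linear_right)
    next
      case False
      have "((\<lambda>x. g (t *\<^sub>R x)) has_derivative (\<lambda>h. fderiv g (t *\<^sub>R x) (t *\<^sub>R h))) (at x)"
        by (rule has_derivative_compose[OF bounded_linear_imp_has_derivative
              has_derivative_fderiv[OF g]])
          (use sub[OF x t] in \<open>simp_all add: bounded_linear_scaleR_right scaleC_of_real\<close>)
      then have "((\<lambda>x. g (t *\<^sub>R x) * complex_of_real (1 / t)) has_derivative
          (\<lambda>h. fderiv g (t *\<^sub>R x) (t *\<^sub>R h) * complex_of_real (1 / t))) (at x)"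
        by (rule has_derivative_mult_left)
      then show ?thesis
        using False by (simp add: k_def scaleC_of_real blinfun.scaleR_right scaleR_conv_of_real)
    qed
  qed (use sub in \<open>auto intro!: continuous_intros\<close>)
  then show ?thesis
    unfolding radial_quotient_integral_eq k_def by (simp add: scaleC_of_real)
qed

lemma radial_antiderivative_scaleC:
  assumes z: "z \<in> ball 0 1"
  shows "integral {0..1} (\<lambda>t. fderiv g (t *\<^sub>R z) (c *\<^sub>C h)) =
    c * integral {0..1} (\<lambda>t. fderiv g (t *\<^sub>R z) h)"
proof -
  have "fderiv g (t *\<^sub>R z) (c *\<^sub>C h) = c * fderiv g (t *\<^sub>R z) h" if "t \<in> {0..1}" for t
    using that z mult_right_mono[of t 1 "norm z"] by (intro fderiv_scaleC[OF g]) simp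
  then have "integral {0..1} (\<lambda>t. fderiv g (t *\<^sub>R z) (c *\<^sub>C h)) =
      integral {0..1} (\<lambda>t. c * fderiv g (t *\<^sub>R z) h)"
    by (intro integral_cong)
  then show ?thesis by simp
qed

text \<open>Dg(t z) z is the derivative of t \<mapsto> g(t z). Together with the derivative formula
  for the antiderivative G it says that the radial derivative of G is g.\<close>

lemma radial_antiderivative_diagonal:
  assumes z: "z \<in> ball 0 1"
  shows "integral {0..1} (\<lambda>t. fderiv g (t *\<^sub>R z) z) = g z"
proof -
  have "((\<lambda>t. fderiv g (0 + t *\<^sub>R z) z) has_integral (g (0 + 1 *\<^sub>R z) - g (0 + 0 *\<^sub>R z))) {0..1}"
  proof (rule fundamental_theorem_of_calculus)
    fix t :: real assume "t \<in> {0..1}"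
    then have "0 + t *\<^sub>R z \<in> ball 0 1" using z mult_right_mono[of t 1 "norm z"] by simp
    then show "((\<lambda>t. g (0 + t *\<^sub>R z)) has_vector_derivative fderiv g (0 + t *\<^sub>R z) z)
        (at t within {0..1})"
      by (rule has_vector_derivative_holomorphic_line[OF g])
  qed simp
  then show ?thesis using g0 by (simp add: integral_unique)
qed

end

section \<open>The Cesaro operator on holomorphic functions\<close>

context
  fixes f \<phi> :: "'a::complex_banach \<Rightarrow> complex"
  assumes f: "f \<in> holomorphic_ball" and \<phi>: "\<phi> \<in> holomorphic_ball"
begin

lemma product_vanishes_at_0: "f 0 * radial_deriv \<phi> 0 = 0"
  using \<phi> by simp

lemma has_derivative_cesaro:
  assumes z: "z \<in> ball 0 1"
  shows "(cesaro \<phi> f has_derivative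
    (\<lambda>h. integral {0..1} (\<lambda>t. fderiv (\<lambda>z. f z * radial_deriv \<phi> z) (t *\<^sub>R z) h))) (at z)"
  using has_derivative_radial_antiderivative[OF mult_radial_deriv_holomorphic[OF f \<phi>]
      product_vanishes_at_0 z]
  by (rule has_derivative_transform_within_open[where s = "ball 0 1"])
    (use z in \<open>auto simp: cesaro_def\<close>)

lemma cesaro_holomorphic: "cesaro \<phi> f \<in> holomorphic_ball"
  unfolding holomorphic_ball_def
  using has_derivative_cesaro radial_antiderivative_scaleC[OF mult_radial_deriv_holomorphic[OF f \<phi>]
      product_vanishes_at_0]
  by (auto simp: cesaro_def simp del: mem_ball) blast

lemma radial_deriv_cesaro:
  assumes z: "z \<in> ball 0 1"
  shows "radial_deriv (cesaro \<phi> f) z = f z * radial_deriv \<phi> z"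
  using radial_deriv_eqI[OF has_derivative_cesaro[OF z]]
    radial_antiderivative_diagonal[OF mult_radial_deriv_holomorphic[OF f \<phi>]
      product_vanishes_at_0 z]
  by simp

lemma cesaro_0: "cesaro \<phi> f 0 = 0"
  using \<phi> by (simp add: cesaro_def)

lemma cesaro_integrable:
  assumes "z \<in> ball 0 1"
  shows "(\<lambda>t. f (t *\<^sub>R z) * radial_deriv \<phi> (t *\<^sub>R z) * complex_of_real (1 / t)) integrable_on {0..1}"
  by (rule radial_quotient_integrable[OF mult_radial_deriv_holomorphic[OF f \<phi>]
        product_vanishes_at_0 assms])

end

lemma cesaro_add:
  fixes f g \<phi> :: "'a::complex_banach \<Rightarrow> complex"
  assumes "f \<in> holomorphic_ball" "g \<in> holomorphic_ball" "\<phi> \<in> holomorphic_ball"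
  shows "cesaro \<phi> (\<lambda>z. f z + g z) = (\<lambda>z. cesaro \<phi> f z + cesaro \<phi> g z)"
proof
  fix z
  show "cesaro \<phi> (\<lambda>z. f z + g z) z = cesaro \<phi> f z + cesaro \<phi> g z"
  proof (cases "z \<in> ball 0 1")
    case True
    from integral_add[OF cesaro_integrable[OF assms(1,3) True] cesaro_integrable[OF assms(2,3) True]]
    show ?thesis
      unfolding cesaro_def if_P[OF True] distrib_right .
  qed (simp add: cesaro_def)
qed

lemma cesaro_cmult: "cesaro \<phi> (\<lambda>z. c * f z) = (\<lambda>z. c * cesaro \<phi> f z)"
  by (simp add: cesaro_def fun_eq_iff mult.assoc del: of_real_divide times_divide_eq_right)

subsection \<open>Norming functionals\<close>

definition sublin :: "('a::real_vector \<Rightarrow> real) \<Rightarrow> bool" where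
  "sublin p \<longleftrightarrow> (\<forall>x y. p (x + y) \<le> p x + p y) \<and> (\<forall>x. \<forall>t>0. p (t *\<^sub>R x) = t * p x)"

lemma sublin_zero: "sublin p \<Longrightarrow> p 0 = 0"
  unfolding sublin_def by (metis mult_2 add_cancel_right_left scaleR_zero_right zero_less_numeral)

lemma sublin_minus: "sublin p \<Longrightarrow> - p (- x) \<le> p x"
  using sublin_zero[of p] unfolding sublin_def by (smt (verit) add.right_inverse)

text \<open>Subadditivity of an infimum needs one functional that is small at x and at y
  simultaneously; directedness provides it.\<close>

lemma sublin_Inf:
  assumes "P \<noteq> {}" and sub: "\<And>p. p \<in> P \<Longrightarrow> sublin p"
    and dir: "\<And>p q. p \<in> P \<Longrightarrow> q \<in> P \<Longrightarrow> \<exists>r\<in>P. \<forall>x. r x \<le> p x \<and> r x \<le> q x"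
    and bdd: "\<And>x. bdd_below ((\<lambda>p. p x) ` P)"
  shows "sublin (\<lambda>x. INF p\<in>P. p x)"
  unfolding sublin_def
proof (intro conjI allI impI)
  fix x y
  have le: "(INF p\<in>P. p (x + y)) \<le> p x + q y" if pq: "p \<in> P" "q \<in> P" for p q
  proof -
    obtain r where r: "r \<in> P" "r x \<le> p x" "r y \<le> q y" using dir[OF pq] by blast
    have "(INF p\<in>P. p (x + y)) \<le> r (x + y)" by (rule cINF_lower[OF bdd r(1)])
    also have "\<dots> \<le> r x + r y" using sub[OF r(1)] by (simp add: sublin_def)
    finally show ?thesis using r by linarith
  qed
  have "(INF p\<in>P. p (x + y)) - q y \<le> (INF p\<in>P. p x)" if "q \<in> P" for q
    by (rule cINF_greatest[OF \<open>P \<noteq> {}\<close>]) (use le that in \<open>smt (verit)\<close>)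
  then have "(INF p\<in>P. p (x + y)) - (INF p\<in>P. p x) \<le> (INF p\<in>P. p y)"
    by (intro cINF_greatest[OF \<open>P \<noteq> {}\<close>]) (smt (verit))
  then show "(INF p\<in>P. p (x + y)) \<le> (INF p\<in>P. p x) + (INF p\<in>P. p y)" by simp
next
  fix x and t :: real assume t: "0 < t"
  have le: "s * (INF p\<in>P. p x) \<le> (INF p\<in>P. p (s *\<^sub>R x))" if "0 < s" for s x
  proof (rule cINF_greatest[OF \<open>P \<noteq> {}\<close>])
    fix p assume p: "p \<in> P"
    have "(INF p\<in>P. p x) \<le> p x" by (rule cINF_lower[OF bdd p])
    then show "s * (INF p\<in>P. p x) \<le> p (s *\<^sub>R x)"
      using sub[OF p] that by (simp add: sublin_def)
  qed
  have "inverse t * (INF p\<in>P. p (t *\<^sub>R x)) \<le> (INF p\<in>P. p x)"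
    using le[of "inverse t" "t *\<^sub>R x"] t by simp
  then have "(INF p\<in>P. p (t *\<^sub>R x)) \<le> t * (INF p\<in>P. p x)"
    using t by (simp add: field_simps)
  then show "(INF p\<in>P. p (t *\<^sub>R x)) = t * (INF p\<in>P. p x)"
    using le[OF t, of x] by simp
qed

text \<open>Pushes p down in the direction -y: t = 0 gives q \<le> p, and t = 1 at the point -y
  gives q(-y) \<le> -p(y), the least value possible for a sublinear functional below p. It serves
  both to make minimal functionals additive and to make a functional attain the norm at a given
  point.\<close>

lemma sublin_shift:
  fixes y :: "'a::real_vector"
  assumes p: "sublin p"
  defines "q \<equiv> \<lambda>x. INF t\<in>{0..}. p (x + t *\<^sub>R y) - t * p y"
  shows "sublin q" and "\<And>x t. 0 \<le> t \<Longrightarrow> q x \<le> p (x + t *\<^sub>R y) - t * p y"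
proof -
  have add: "p (u + v) \<le> p u + p v" for u v using p by (simp add: sublin_def)
  have hom: "p (t *\<^sub>R u) = t * p u" if "0 \<le> t" for t u
    using p that sublin_zero[OF p] by (cases "t = 0") (simp_all add: sublin_def)
  have low: "- p (- x) \<le> p (x + t *\<^sub>R y) - t * p y" if "0 \<le> t" for x t
    using add[of "x + t *\<^sub>R y" "- x"] hom[OF that, of y] by simp
  have bdd: "bdd_below ((\<lambda>t. p (x + t *\<^sub>R y) - t * p y) ` {0..})" for x
    by (rule bdd_belowI[of _ "- p (- x)"]) (use low in auto)
  show lower: "q x \<le> p (x + t *\<^sub>R y) - t * p y" if "0 \<le> t" for x t
    unfolding q_def by (rule cINF_lower[OF bdd]) (use that in auto)
  have great: "c \<le> q x" if "\<And>t. 0 \<le> t \<Longrightarrow> c \<le> p (x + t *\<^sub>R y) - t * p y" for c x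
    unfolding q_def by (rule cINF_greatest) (use that in auto)
  show "sublin q"
    unfolding sublin_def
  proof (intro conjI allI impI)
    fix u v
    have le: "q (u + v) \<le> (p (u + s *\<^sub>R y) - s * p y) + (p (v + t *\<^sub>R y) - t * p y)"
      if "0 \<le> s" "0 \<le> t" for s t
      using lower[of "s + t" "u + v"] that add[of "u + s *\<^sub>R y" "v + t *\<^sub>R y"]
      by (simp add: algebra_simps)
    have "q (u + v) - (p (v + t *\<^sub>R y) - t * p y) \<le> q u" if "0 \<le> t" for t
      by (rule great) (use le[OF _ that] in \<open>simp add: algebra_simps\<close>)
    then have "q (u + v) - q u \<le> q v"
      by (intro great) (simp add: algebra_simps)
    then show "q (u + v) \<le> q u + q v" by simp
  next
    fix u and s :: real assume s: "0 < s"
    have le: "s * q u \<le> q (s *\<^sub>R u)" if s: "0 < s" for s u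
    proof (rule great)
      fix t :: real assume t: "0 \<le> t"
      have "q u \<le> p (u + (t / s) *\<^sub>R y) - (t / s) * p y" using lower[of "t / s" u] s t by auto
      then have "s * q u \<le> s * p (u + (t / s) *\<^sub>R y) - t * p y"
        using s by (simp add: field_simps)
      also have "s * p (u + (t / s) *\<^sub>R y) = p (s *\<^sub>R u + t *\<^sub>R y)"
        using hom[of s "u + (t / s) *\<^sub>R y"] s by (simp add: scaleR_add_right)
      finally show "s * q u \<le> p (s *\<^sub>R u + t *\<^sub>R y) - t * p y" .
    qed
    have "inverse s * q (s *\<^sub>R u) \<le> q u"
      using le[of "inverse s" "s *\<^sub>R u"] s by simp
    then have "q (s *\<^sub>R u) \<le> s * q u" using s by (simp add: field_simps)
    then show "q (s *\<^sub>R u) = s * q u" using le[OF s, of u] by simp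
  qed
qed

text \<open>Minimality against the functionals \<open>x \<mapsto> inf\<^sub>t (p (x + t y) - t p y)\<close> of the previous lemma
  forces superadditivity.\<close>

lemma minimal_sublin_linear:
  assumes p: "sublin p" and min: "\<And>q. sublin q \<Longrightarrow> q \<le> p \<Longrightarrow> q = p"
  shows "linear p"
proof -
  have add: "p (x + y) = p x + p y" for x y
  proof (rule antisym)
    show "p (x + y) \<le> p x + p y" using p by (simp add: sublin_def)
    define q where "q = (\<lambda>x. INF t\<in>{0..}. p (x + t *\<^sub>R y) - t * p y)"
    have "q \<le> p"
      using sublin_shift(2)[OF p order_refl, of _ y] by (simp add: q_def le_fun_def)
    with sublin_shift(1)[OF p, of y] have "q = p" by (intro min) (simp_all add: q_def)
    then show "p x + p y \<le> p (x + y)"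
      using sublin_shift(2)[OF p zero_le_one, of x y] by (simp add: q_def fun_eq_iff)
  qed
  have neg: "p (- x) = - p x" for x
    using add[of x "- x"] sublin_zero[OF p] by simp
  show ?thesis
  proof (rule linearI)
    fix t x
    show "p (t *\<^sub>R x) = t *\<^sub>R p x"
    proof (cases t "0::real" rule: linorder_cases)
      case less
      then have "p ((- t) *\<^sub>R x) = - t * p x"
        using p unfolding sublin_def by (meson neg_0_less_iff_less)
      then show ?thesis using neg[of "t *\<^sub>R x"] by simp
    qed (use p sublin_zero[OF p] in \<open>simp_all add: sublin_def\<close>)
  qed (rule add)
qed

text \<open>A minimal sublinear functional below q is linear, and Zorn's lemma yields one. Working
  with functionals on the whole space avoids extending partial ones subspace by subspace.\<close>

theorem Hahn_Banach_sublin: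
  assumes q: "sublin q"
  obtains u where "linear u" "u \<le> q"
proof -
  define A where "A = {p. sublin p \<and> p \<le> q}"
  have low: "- q (- x) \<le> p x" if "p \<in> A" for p x
  proof -
    have "- q (- x) \<le> - p (- x)" using that by (simp add: A_def le_fun_def)
    also have "\<dots> \<le> p x" using that by (intro sublin_minus) (simp add: A_def)
    finally show ?thesis .
  qed
  have "\<exists>m\<in>A. \<forall>a\<in>A. a \<le> m \<longrightarrow> a = m"
  \<comment> \<open>The order is reversed, so a maximal element is a minimal functional. A nonempty
    chain is bounded by its pointwise infimum, which is finite because every member lies above x
    \<mapsto> -q(-x).\<close>
  proof (rule predicate_Zorn)
    show "partial_order_on A (relation_of (\<lambda>x y. y \<le> x) A)"
      by (auto simp: partial_order_on_def preorder_on_def refl_on_def trans_def antisym_def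
          relation_of_def)
    fix C assume C: "C \<in> Chains (relation_of (\<lambda>x y. y \<le> x) A)"
    then have "C \<subseteq> A" and tot: "\<And>a b. a \<in> C \<Longrightarrow> b \<in> C \<Longrightarrow> a \<le> b \<or> b \<le> a"
      by (auto simp: Chains_def relation_of_def)
    show "\<exists>u\<in>A. \<forall>a\<in>C. u \<le> a"
    proof (cases "C = {}")
      case True
      then show ?thesis using q by (auto simp: A_def)
    next
      case False
      have bdd: "bdd_below ((\<lambda>p. p x) ` C)" for x
        by (rule bdd_belowI[of _ "- q (- x)"]) (use low \<open>C \<subseteq> A\<close> in auto)
      define u where "u = (\<lambda>x. INF p\<in>C. p x)"
      have le: "u \<le> a" if "a \<in> C" for a
        unfolding u_def le_fun_def using cINF_lower[OF bdd that] by blast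
      have "sublin u"
        unfolding u_def
      proof (rule sublin_Inf[OF False _ _ bdd])
        show "sublin p" if "p \<in> C" for p using that \<open>C \<subseteq> A\<close> by (auto simp: A_def)
        show "\<exists>r\<in>C. \<forall>x. r x \<le> p x \<and> r x \<le> q x" if "p \<in> C" "q \<in> C" for p q
          using tot[OF that] that by (auto simp: le_fun_def)
      qed
      moreover have "u \<le> q"
      proof -
        obtain a where "a \<in> C" using False by blast
        with le \<open>C \<subseteq> A\<close> show ?thesis by (force simp: A_def intro: order_trans)
      qed
      ultimately show ?thesis using le by (auto simp: A_def)
    qed
  qed
  then obtain m where m: "m \<in> A" "\<And>a. a \<in> A \<Longrightarrow> a \<le> m \<Longrightarrow> a = m" by blast
  have "linear m"
    by (rule minimal_sublin_linear) (use m order_trans in \<open>auto simp: A_def\<close>)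
  with m that show ?thesis by (auto simp: A_def)
qed

text \<open>Hahn-Banach is applied to the norm shifted along z: a linear u \<le> q satisfies u(-z)
  \<le> q(-z) \<le> -\<open>norm z\<close>, which forces equality at z.\<close>

lemma norming_real_functional:
  fixes z :: "'a::real_normed_vector"
  obtains u :: "'a \<Rightarrow> real" where "linear u" "\<And>x. u x \<le> norm x" "u z = norm z"
proof -
  have sn: "sublin (norm :: 'a \<Rightarrow> real)" by (simp add: sublin_def norm_triangle_ineq)
  define q where "q = (\<lambda>x. INF t\<in>{0..}. norm (x + t *\<^sub>R z) - t * norm z)"
  have q: "sublin q" "\<And>x t. 0 \<le> t \<Longrightarrow> q x \<le> norm (x + t *\<^sub>R z) - t * norm z"
    using sublin_shift[OF sn, where y = z] unfolding q_def by blast+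
  obtain u where u: "linear u" "u \<le> q" using Hahn_Banach_sublin[OF q(1)] .
  have le: "u x \<le> norm x" for x
    using u(2) q(2)[of 0 x] by (simp add: le_fun_def) (metis order_trans)
  have "u (- z) \<le> - norm z"
    using u(2) q(2)[of 1 "- z"] by (simp add: le_fun_def) (metis order_trans)
  then have "norm z \<le> u z" using u(1) by (simp add: linear_neg)
  with le[of z] have "u z = norm z" by simp
  with u(1) le that show ?thesis by blast
qed

text \<open>The usual complexification l(x) = u(x) - i u(i x) of a real norming functional. At z the
  real part already equals \<open>norm z\<close>, so the modulus bound leaves no room for an
  imaginary part.\<close>

lemma norming_functional:
  fixes z :: "'a::complex_banach"
  obtains l :: "'a \<Rightarrow> complex"
  where "bounded_linear l" "\<And>c x. l (c *\<^sub>C x) = c * l x" "\<And>x. cmod (l x) \<le> norm x"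
    "l z = complex_of_real (norm z)"
proof -
  obtain u :: "'a \<Rightarrow> real" where u: "linear u" "\<And>x. u x \<le> norm x" "u z = norm z"
    using norming_real_functional[of z] by blast
  define l where "l = (\<lambda>x. Complex (u x) (- u (\<i> *\<^sub>C x)))"
  have add: "l (x + y) = l x + l y" for x y
    using u(1) by (simp add: l_def complex_eq_iff scaleC_add_right linear_add)
  have scal: "u (c *\<^sub>C x) = Re c * u x + Im c * u (\<i> *\<^sub>C x)" for c x
  proof -
    have "c *\<^sub>C x = Re c *\<^sub>R x + Im c *\<^sub>R (\<i> *\<^sub>C x)"
      by (simp add: scaleC_scaleC mult.commute flip: scaleC_of_real scaleC_add_left complex_eq)
    then show ?thesis using u(1) by (simp add: linear_add linear_scale)
  qed
  have hom: "l (c *\<^sub>C x) = c * l x" for c x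
    using scal[of c x] scal[of "\<i> * c" x]
    by (simp add: l_def complex_eq_iff scaleC_scaleC)
  have bd: "cmod (l x) \<le> norm x" for x
  proof -
    \<comment> \<open>The rotation that makes l(c x) real and nonnegative; then |l x| = u(c x), and
      the real bound applies.\<close>
    define c where "c = cnj (sgn (l x))"
    have "c * l x = complex_of_real ((cmod (l x))\<^sup>2 / cmod (l x))"
      by (simp add: c_def sgn_eq complex_norm_square[unfolded of_real_power, symmetric] mult.commute)
    then have "complex_of_real (cmod (l x)) = c * l x"
      by (simp add: power2_eq_square)
    also have "\<dots> = l (c *\<^sub>C x)" by (simp add: hom)
    finally have "cmod (l x) = u (c *\<^sub>C x)" by (simp add: l_def complex_eq_iff)
    also have "\<dots> \<le> norm (c *\<^sub>C x)" by (rule u)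
    also have "\<dots> \<le> norm x" by (simp add: norm_scaleC c_def norm_sgn)
    finally show ?thesis .
  qed
  have "bounded_linear l"
  proof (rule bounded_linear_intro)
    show "l (x + y) = l x + l y" for x y by (rule add)
    show "l (r *\<^sub>R x) = r *\<^sub>R l x" for r x
      using hom[of "complex_of_real r" x] by (simp add: scaleC_of_real scaleR_conv_of_real)
    show "norm (l x) \<le> norm x * 1" for x using bd by simp
  qed
  moreover have "l z = complex_of_real (norm z)"
  proof -
    have "Re (l z) = norm z" using u by (simp add: l_def)
    moreover have "(Re (l z))\<^sup>2 + (Im (l z))\<^sup>2 \<le> (norm z)\<^sup>2"
      using bd[of z] by (metis cmod_power2 norm_ge_zero power_mono)
    ultimately show ?thesis by (simp add: complex_eq_iff)
  qed
  ultimately show ?thesis using hom bd that by blast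
qed

subsection \<open>Lacunary polynomials comparable to an inverse weight\<close>

lemma normal_weight_pos: "normal_weight \<omega> \<Longrightarrow> 0 \<le> r \<Longrightarrow> r < 1 \<Longrightarrow> 0 < \<omega> r"
  by (simp add: normal_weight_def)

lemma normal_weight_continuous:
  "normal_weight \<omega> \<Longrightarrow> S \<subseteq> {0..<1} \<Longrightarrow> continuous_on S \<omega>"
  using continuous_on_subset normal_weight_def by blast

lemma normal_weight_bounds:
  assumes "normal_weight \<omega>" "0 \<le> d" "d < 1"
  obtains m M where "0 < m" "\<And>r. 0 \<le> r \<Longrightarrow> r \<le> d \<Longrightarrow> m \<le> \<omega> r"
    "\<And>r. 0 \<le> r \<Longrightarrow> r \<le> d \<Longrightarrow> \<omega> r \<le> M"
proof -
  have c: "continuous_on {0..d} \<omega>"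
    using assms by (intro normal_weight_continuous) auto
  have ne: "{0..d} \<noteq> {}" using assms by auto
  obtain u where "u \<in> {0..d}" "\<forall>r\<in>{0..d}. \<omega> u \<le> \<omega> r"
    using continuous_attains_inf[OF compact_Icc ne c] by blast
  moreover obtain v where "v \<in> {0..d}" "\<forall>r\<in>{0..d}. \<omega> r \<le> \<omega> v"
    using continuous_attains_sup[OF compact_Icc ne c] by blast
  ultimately show ?thesis
    using that[of "\<omega> u" "\<omega> v"] normal_weight_pos[OF assms(1), of u] assms by auto
qed

text \<open>Bounds sums whose exponents are distances to a moving index n. Distinct exponents reduce
  them to a geometric series, with a constant independent of n and of the number of terms.\<close>

lemma sum_power_inj_le:
  fixes p :: real
  assumes "finite A" "inj_on g A" "0 \<le> p" "p < 1"
  shows "(\<Sum>k\<in>A. p ^ g k) \<le> 1 / (1 - p)"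
proof -
  have "(\<Sum>k\<in>A. p ^ g k) = (\<Sum>j\<in>g ` A. p ^ j)"
    using assms by (simp add: sum.reindex)
  also have "\<dots> \<le> (\<Sum>j. p ^ j)"
    using assms by (intro sum_le_suminf) auto
  also have "\<dots> = 1 / (1 - p)"
    using assms by (simp add: suminf_geometric)
  finally show ?thesis .
qed

text \<open>One term of the exponential series, of degree at least b + 1, absorbs the power and
  leaves a spare factor 1/u. Along u growing like 2^j that factor is summable.\<close>

lemma powr_mult_exp_minus_le:
  fixes u b :: real
  assumes "1 \<le> u" "b + 1 \<le> real m"
  shows "u powr b * exp (- u) \<le> fact m / u"
proof -
  have "u powr (b + 1) \<le> u powr real m"
    using assms by (intro powr_mono) auto
  also have "\<dots> = u ^ m"
    using assms by (simp add: powr_realpow)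
  also have "\<dots> \<le> fact m * exp u"
  proof -
    have "u ^ m /\<^sub>R fact m \<le> (\<Sum>n. u ^ n /\<^sub>R fact n)"
      using sum_le_suminf[OF summable_exp_generic[of u], of "{m}"] assms by auto
    then have "u ^ m / fact m \<le> exp u"
      by (simp add: exp_def field_simps)
    then show ?thesis by (simp add: field_simps)
  qed
  finally have "u powr b * u \<le> fact m * exp u"
    using assms by (simp add: powr_add)
  then show ?thesis
    using assms by (simp add: exp_minus field_simps)
qed

lemma dyadic_scale:
  fixes y :: real
  assumes "0 < y" "y \<le> 1"
  obtains n :: nat where "2 ^ n * y \<le> 1" "1 < 2 ^ Suc n * y"
proof -
  obtain n0 :: nat where "1 / y < 2 ^ n0"
    using real_arch_pow[of 2 "1 / y"] by auto
  then have ex: "1 < 2 ^ Suc n0 * y"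
    using assms by (simp add: field_simps)
  define n where "n = (LEAST n. 1 < 2 ^ Suc n * y)"
  have "1 < 2 ^ Suc n * y"
    unfolding n_def by (rule LeastI[of _ n0]) (rule ex)
  moreover have "2 ^ n * y \<le> 1"
  proof (cases n)
    case (Suc j)
    then have "\<not> 1 < 2 ^ Suc j * y"
      using not_less_Least[of j "\<lambda>n. 1 < 2 ^ Suc n * y"] by (simp add: n_def)
    then show ?thesis using Suc by simp
  qed (use assms in simp)
  ultimately show ?thesis using that by blast
qed

text \<open>Bernoulli's inequality with the full exponent gives only the bound 0; with half the
  exponent it gives 1/2, which is then squared.\<close>

lemma power_two_lower:
  assumes "0 < (n::nat)"
  shows "1 / 4 \<le> (1 - 1 / 2 ^ n :: real) ^ (2 ^ n)"
proof -
  obtain j where n: "n = Suc j" using assms by (cases n) auto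
  have "1 + real (2 ^ j) * (- (1 / 2 ^ n)) \<le> (1 + - (1 / 2 ^ n)) ^ (2 ^ j)"
    by (rule Bernoulli_inequality) simp
  then have "1 / 2 \<le> (1 - 1 / 2 ^ n :: real) ^ (2 ^ j)"
    by (simp add: n)
  then have "(1 / 2)\<^sup>2 \<le> ((1 - 1 / 2 ^ n :: real) ^ (2 ^ j))\<^sup>2"
    by (rule power_mono) simp
  also have "\<dots> = (1 - 1 / 2 ^ n) ^ (2 ^ n)"
    by (simp only: n power_mult[symmetric] power_Suc mult.commute)
  finally show ?thesis
    by (simp add: power2_eq_square)
qed

text \<open>With \<open>y = 1 - x\<close> and \<open>n\<close> such that \<open>2\<^sup>n y\<close> is about \<open>1\<close>, the \<open>k\<close>-th term relative to
  \<open>1/\<omega> x\<close> decays geometrically in \<open>n - k\<close> for \<open>k \<le> n\<close> (exponent \<open>a\<close> of the weight) and, by the factor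
  \<open>exp (- 2\<^sup>k y)\<close>, in \<open>k - n\<close> for \<open>k > n\<close> (exponent \<open>b\<close>); the term \<open>k = n\<close> alone gives the lower bound.\<close>

lemma lacunary_sum_bounds:
  assumes \<omega>: "normal_weight \<omega>"
  obtains c C :: real and k0 :: nat
  where "0 < c" "0 < C"
    "\<And>x N. 0 \<le> x \<Longrightarrow> x < 1 \<Longrightarrow> 1 + (\<Sum>k=k0..N. x ^ (2 ^ k) / \<omega> (1 - 1 / 2 ^ k)) \<le> C / \<omega> x"
    "\<And>x N. 0 \<le> x \<Longrightarrow> x < 1 - 1 / 2 ^ Suc N \<Longrightarrow>
       c / \<omega> x \<le> 1 + (\<Sum>k=k0..N. x ^ (2 ^ k) / \<omega> (1 - 1 / 2 ^ k))"
proof -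
  have pos: "0 < \<omega> r" if "0 \<le> r" "r < 1" for r
    using normal_weight_pos[OF \<omega> that] .
  obtain \<delta> a b where \<delta>: "0 \<le> \<delta>" "\<delta> < 1" and ab: "0 < a" "a < b"
    and anti: "antimono_on {\<delta>..<1} (\<lambda>r. \<omega> r / (1 - r) powr a)"
    and mono: "mono_on {\<delta>..<1} (\<lambda>r. \<omega> r / (1 - r) powr b)"
    using \<omega> unfolding normal_weight_def by blast
  \<comment> \<open>The two monotonicity conditions read for 1/\<omega>: from s to t it grows at
    least like the power a and at most like the power b of (1 - s)/(1 - t).\<close>
  have V_anti: "1 / \<omega> s \<le> 1 / \<omega> t * ((1 - t) / (1 - s)) powr a"
    if "\<delta> \<le> s" "s \<le> t" "t < 1" for s t
  proof -
    have "\<omega> t / (1 - t) powr a \<le> \<omega> s / (1 - s) powr a"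
      using anti that by (auto simp: monotone_on_def)
    then have "\<omega> t * (1 - s) powr a \<le> \<omega> s * (1 - t) powr a"
      using that by (simp add: field_simps)
    then show ?thesis
      using pos[of s] pos[of t] that \<delta> by (simp add: powr_divide field_simps)
  qed
  have V_mono: "1 / \<omega> t \<le> 1 / \<omega> s * ((1 - s) / (1 - t)) powr b"
    if "\<delta> \<le> s" "s \<le> t" "t < 1" for s t
  proof -
    have "\<omega> s / (1 - s) powr b \<le> \<omega> t / (1 - t) powr b"
      using mono that by (auto simp: monotone_on_def)
    then have "\<omega> s * (1 - t) powr b \<le> \<omega> t * (1 - s) powr b"
      using that by (simp add: field_simps)
    then show ?thesis
      using pos[of s] pos[of t] that \<delta> by (simp add: powr_divide field_simps)
  qed
  obtain k1 :: nat where "1 / (1 - \<delta>) < 2 ^ k1"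
    using real_arch_pow[of 2 "1 / (1 - \<delta>)"] by auto
  \<comment> \<open>From this index on all nodes lie beyond \<delta>. The successor makes k0
    positive, as the lower bound by 1/4 on the term k = n requires.\<close>
  define k0 where "k0 = Suc k1"
  define d where "d = 1 - 1 / (2::real) ^ k0"
  have "1 / 2 ^ k1 < 1 - \<delta>"
    using \<open>1 / (1 - \<delta>) < 2 ^ k1\<close> \<delta> by (simp add: field_simps)
  moreover have "1 / (2::real) ^ k0 \<le> 1 / 2 ^ k1" by (simp add: k0_def field_simps)
  ultimately have d: "\<delta> \<le> d" "0 \<le> d" "d < 1" using \<delta> by (auto simp: d_def)
  have node: "d \<le> 1 - 1 / (2::real) ^ k" "1 - 1 / (2::real) ^ k < 1" "0 \<le> 1 - 1 / (2::real) ^ k"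
    if "k0 \<le> k" for k
  proof -
    have "(2::real) ^ k0 \<le> 2 ^ k" using that by (rule power_increasing) simp
    then show "d \<le> 1 - 1 / (2::real) ^ k" by (simp add: d_def field_simps)
    then show "0 \<le> 1 - 1 / (2::real) ^ k" using d by simp
  qed auto
  have node_pos: "0 < \<omega> (1 - 1 / 2 ^ k)" if "k0 \<le> k" for k
    using pos node(2,3) that by blast
  obtain m M0 where m: "0 < m" "\<And>r. 0 \<le> r \<Longrightarrow> r \<le> d \<Longrightarrow> m \<le> \<omega> r"
    and M0: "\<And>r. 0 \<le> r \<Longrightarrow> r \<le> d \<Longrightarrow> \<omega> r \<le> M0"
    using normal_weight_bounds[OF \<omega> d(2,3)] by blast
  \<comment> \<open>The bound extends to all of [0,1) because \<omega> stays below \<omega> d beyond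
    d. It lets the constant term 1 be absorbed into a multiple of 1/\<omega>.\<close>
  have M: "\<omega> r \<le> M0" if r: "0 \<le> r" "r < 1" for r
  proof (cases "r \<le> d")
    case False
    then have "1 / \<omega> d \<le> 1 / \<omega> r * ((1 - r) / (1 - d)) powr a"
      using d r by (intro V_anti) auto
    also have "\<dots> \<le> 1 / \<omega> r * 1"
      using False d r pos[of r] ab
      by (intro mult_left_mono powr_le1) (auto simp: field_simps)
    finally have "\<omega> r \<le> \<omega> d"
      using pos[of r] pos[of d] d r by (simp add: field_simps)
    then show ?thesis using M0[of d] d by linarith
  qed (use M0 r in simp)
  have "m \<le> M0" using m(2)[of 0] M0[of 0] d by simp
  define q where "q = (1/2) powr a"
  have q: "0 \<le> q" "q < 1"
    using ab powr_less_mono'[of "1/2" 0 a] by (auto simp: q_def)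
  obtain l :: nat where l: "b + 1 \<le> real l" using real_arch_simple by blast
  define g where "g = (\<lambda>N x. 1 + (\<Sum>k=k0..N. x ^ (2 ^ k) / \<omega> (1 - 1 / 2 ^ k)))"
  \<comment> \<open>The totals of two geometric series: ratio q for the indices up to n, ratio 1/2
    with factor \<open>fact l\<close> for the later ones.\<close>
  define C1 where "C1 = 1 / (1 - q) + 2 * fact l"
  have "0 < C1" using q by (simp add: C1_def add_pos_pos)
  have upper: "g N x \<le> (M0 + C1) / \<omega> x" if x: "d \<le> x" "x < 1" for N x
  proof -
    define y where "y = 1 - x"
    have y: "0 < y" "y \<le> 1" using x d by (auto simp: y_def)
    obtain n where n: "2 ^ n * y \<le> 1" "1 < 2 ^ Suc n * y" using dyadic_scale[OF y] .
    define V where "V = 1 / \<omega> x"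
    have "0 < V" using pos[of x] x d by (simp add: V_def)
    define h where "h = (\<lambda>k. if k \<le> n then q ^ (n - k) else fact l * (1/2) ^ (k - Suc n))"
    have h0: "0 \<le> h k" for k using q by (simp add: h_def)
    have bound: "x ^ (2 ^ k) / \<omega> (1 - 1 / 2 ^ k) \<le> V * h k" if k: "k0 \<le> k" for k
    proof (cases "k \<le> n")
      case True
      have two: "(2::real) ^ n = 2 ^ k * 2 ^ (n - k)"
        using True by (simp flip: power_add)
      have le: "y * 2 ^ k \<le> (1/2) ^ (n - k)"
        using n(1) by (simp add: two power_one_over field_simps)
      have "2 ^ k * y \<le> 2 ^ n * y"
        using True y by (intro mult_right_mono power_increasing) auto
      then have "1 - 1 / 2 ^ k \<le> x"
        using n(1) by (simp add: y_def field_simps)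
      then have "1 / \<omega> (1 - 1 / 2 ^ k) \<le> V * (y * 2 ^ k) powr a"
        using V_anti[of "1 - 1 / 2 ^ k" x] node[OF k] d x by (simp add: V_def y_def)
      also have "\<dots> \<le> V * ((1/2) ^ (n - k)) powr a"
        using le y ab \<open>0 < V\<close> by (intro mult_left_mono powr_mono2) auto
      also have "((1/2::real) ^ (n - k)) powr a = q ^ (n - k)"
        by (simp add: q_def powr_power mult.commute flip: powr_realpow powr_powr)
          (simp add: powr_powr mult.commute flip: powr_realpow)
      finally have "1 / \<omega> (1 - 1 / 2 ^ k) \<le> V * h k" using True by (simp add: h_def)
      moreover have "x ^ (2 ^ k) / \<omega> (1 - 1 / 2 ^ k) \<le> 1 / \<omega> (1 - 1 / 2 ^ k)"
        using node_pos[OF k] x d by (intro divide_right_mono power_le_one) auto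
      ultimately show ?thesis by linarith
    next
      case False
      define u where "u = 2 ^ k * y"
      have two: "(2::real) ^ k = 2 ^ Suc n * 2 ^ (k - Suc n)"
        using False by (simp flip: power_add del: power_Suc)
      have "1 * 2 ^ (k - Suc n) \<le> (2 ^ Suc n * y) * 2 ^ (k - Suc n)"
        using n(2) by (intro mult_right_mono) auto
      then have u2: "2 ^ (k - Suc n) \<le> u" by (simp add: u_def two mult_ac)
      have "1 \<le> (2::real) ^ (k - Suc n)" by simp
      with u2 have u: "1 \<le> u" by linarith
      then have "x \<le> 1 - 1 / 2 ^ k" by (simp add: u_def y_def field_simps)
      then have "1 / \<omega> (1 - 1 / 2 ^ k) \<le> V * u powr b"
        using V_mono[of x "1 - 1 / 2 ^ k"] node[OF k] d x
        by (simp add: V_def y_def u_def mult.commute)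
      moreover have "x ^ (2 ^ k) \<le> exp (- u)"
      proof -
        have "x \<le> exp (- y)" using exp_ge_add_one_self[of "- y"] by (simp add: y_def)
        then have "x ^ (2 ^ k) \<le> exp (- y) ^ (2 ^ k)" using x d by (intro power_mono) auto
        also have "\<dots> = exp (- u)" by (simp add: u_def flip: exp_of_nat_mult)
        finally show ?thesis .
      qed
      ultimately have "x ^ (2 ^ k) * (1 / \<omega> (1 - 1 / 2 ^ k)) \<le> exp (- u) * (V * u powr b)"
        using node_pos[OF k] by (intro mult_mono) auto
      also have "\<dots> = V * (u powr b * exp (- u))" by simp
      also have "\<dots> \<le> V * (fact l / u)"
        using \<open>0 < V\<close> powr_mult_exp_minus_le[OF u l] by (intro mult_left_mono) auto
      also have "\<dots> \<le> V * (fact l / 2 ^ (k - Suc n))"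
        using \<open>0 < V\<close> u2 u by (intro mult_left_mono divide_left_mono) auto
      also have "\<dots> = V * h k" using False by (simp add: h_def power_one_over)
      finally show ?thesis by simp
    qed
    have "(\<Sum>k=k0..N. x ^ (2 ^ k) / \<omega> (1 - 1 / 2 ^ k)) \<le> (\<Sum>k=k0..N. V * h k)"
      by (intro sum_mono bound) auto
    also have "\<dots> = V * (\<Sum>k=k0..N. h k)" by (simp add: sum_distrib_left)
    \<comment> \<open>Passing to a larger index set removes k0 from the bound and treats N below n
      and N above n alike.\<close>
    also have "(\<Sum>k=k0..N. h k) \<le> (\<Sum>k\<in>{..n} \<union> {Suc n..N}. h k)"
      by (intro sum_mono2) (use h0 in auto)
    also have "\<dots> = (\<Sum>k\<in>{..n}. h k) + (\<Sum>k\<in>{Suc n..N}. h k)"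
      by (intro sum.union_disjoint) auto
    also have "(\<Sum>k\<in>{..n}. h k) = (\<Sum>k\<in>{..n}. q ^ (n - k))"
      by (intro sum.cong) (auto simp: h_def)
    also have "(\<Sum>k\<in>{Suc n..N}. h k) = fact l * (\<Sum>k\<in>{Suc n..N}. (1/2) ^ (k - Suc n))"
      unfolding sum_distrib_left by (intro sum.cong) (auto simp: h_def)
    also have "(\<Sum>k\<in>{..n}. q ^ (n - k)) \<le> 1 / (1 - q)"
      using q by (intro sum_power_inj_le) (auto simp: inj_on_def)
    also have "(\<Sum>k\<in>{Suc n..N}. (1/2) ^ (k - Suc n)) \<le> 1 / (1 - 1/2 :: real)"
      by (intro sum_power_inj_le) (auto simp: inj_on_def)
    finally have "(\<Sum>k=k0..N. x ^ (2 ^ k) / \<omega> (1 - 1 / 2 ^ k)) \<le> V * C1"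
      using \<open>0 < V\<close> by (simp add: C1_def mult.commute)
    moreover have "1 \<le> V * M0"
      using M[of x] pos[of x] x d by (simp add: V_def)
    ultimately show ?thesis by (simp add: g_def V_def add_divide_distrib)
  qed
  have g_mono: "g N x \<le> g N x'" if "0 \<le> x" "x \<le> x'" for N x x'
    unfolding g_def
    by (intro add_left_mono sum_mono divide_right_mono power_mono)
      (use that node_pos in \<open>auto intro: less_imp_le\<close>)
  \<comment> \<open>The factor M0/m \<ge> 1 pays for x below d, where the estimate at d is used and
    \<omega> d is then exchanged for \<omega> x.\<close>
  define C where "C = (M0 + C1) * (M0 / m)"
  have "0 < C" using \<open>0 < C1\<close> \<open>m \<le> M0\<close> m by (simp add: C_def)
  have up: "g N x \<le> C / \<omega> x" if x: "0 \<le> x" "x < 1" for N x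
  proof (cases "d \<le> x")
    case True
    have "g N x \<le> (M0 + C1) / \<omega> x" using upper True x by blast
    also have "(M0 + C1) * 1 \<le> C"
      unfolding C_def using \<open>m \<le> M0\<close> m(1) \<open>0 < C1\<close> by (intro mult_left_mono) auto
    then have "(M0 + C1) / \<omega> x \<le> C / \<omega> x"
      using pos[OF x] by (intro divide_right_mono) auto
    finally show ?thesis .
  next
    case False
    have "g N x \<le> g N d" using False x by (intro g_mono) auto
    also have "\<dots> \<le> (M0 + C1) / \<omega> d" using upper d by blast
    also have "\<dots> \<le> (M0 + C1) / m"
      using m d \<open>m \<le> M0\<close> \<open>0 < C1\<close> by (intro divide_left_mono) (auto intro!: mult_pos_pos pos)
    also have "\<dots> = C / M0" using m \<open>m \<le> M0\<close> by (simp add: C_def)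
    also have "\<dots> \<le> C / \<omega> x"
      using M[OF x] pos[OF x] \<open>0 < C\<close> m \<open>m \<le> M0\<close> by (intro divide_left_mono) auto
    finally show ?thesis .
  qed
  \<comment> \<open>For x below d the constant term 1 suffices, since \<omega> x \<ge> m. Beyond d
    the term k = n contributes a factor 1/4 from the power and loses at most 2^b between its node
    and x.\<close>
  define c where "c = min m (1 / 4 / 2 powr b)"
  have "0 < c" using m by (simp add: c_def)
  have lo: "c / \<omega> x \<le> g N x" if x: "0 \<le> x" "x < 1 - 1 / 2 ^ Suc N" for N x
  proof (cases "x < d")
    case True
    have "x < 1" using True d by simp
    have "c \<le> \<omega> x" using m(2)[of x] True x by (simp add: c_def)
    then have "c / \<omega> x \<le> 1" using pos[OF x(1) \<open>x < 1\<close>] by simp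
    also have "1 \<le> g N x"
      unfolding g_def using x node_pos
      by (auto intro!: sum_nonneg divide_nonneg_pos)
    finally show ?thesis .
  next
    case False
    have "0 < 1 / (2::real) ^ Suc N" by simp
    then have x1: "x < 1" using x by linarith
    define y where "y = 1 - x"
    have y: "0 < y" "y \<le> 1" using x x1 by (auto simp: y_def)
    obtain n where n: "2 ^ n * y \<le> 1" "1 < 2 ^ Suc n * y" using dyadic_scale[OF y] .
    have "1 / 2 ^ Suc N < y" using x by (simp add: y_def)
    then have "1 < 2 ^ Suc N * y" by (simp add: field_simps)
    \<comment> \<open>The cutoff condition on x says 1 < 2^(N+1) y; with 2^n y \<le> 1 it places the
      scale of x among the summed indices.\<close>
    have "n \<le> N"
    proof (rule ccontr)
      assume "\<not> n \<le> N"
      then have "Suc N \<le> n" by simp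
      then have "(2::real) ^ Suc N * y \<le> 2 ^ n * y"
        using y by (intro mult_right_mono power_increasing) auto
      with n(1) \<open>1 < 2 ^ Suc N * y\<close> show False by linarith
    qed
    have "k0 \<le> n"
    proof (rule ccontr)
      assume "\<not> k0 \<le> n"
      then have "(2::real) ^ Suc n * y \<le> 2 ^ k0 * y"
        using y by (intro mult_right_mono power_increasing) auto
      moreover have "2 ^ k0 * y \<le> 1" using False by (simp add: y_def d_def field_simps)
      ultimately show False using n by linarith
    qed
    have le: "1 - 1 / 2 ^ n \<le> x" using n(1) by (simp add: y_def field_simps)
    have "1 / \<omega> x \<le> 1 / \<omega> (1 - 1 / 2 ^ n) * (1 / (2 ^ n * y)) powr b"
      using V_mono[OF _ le x1] node[OF \<open>k0 \<le> n\<close>] d by (simp add: y_def)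
    also have "\<dots> \<le> 1 / \<omega> (1 - 1 / 2 ^ n) * 2 powr b"
      using n y ab node_pos[OF \<open>k0 \<le> n\<close>]
      by (intro mult_left_mono powr_mono2) (auto simp: field_simps)
    finally have V: "1 / \<omega> x \<le> 1 / \<omega> (1 - 1 / 2 ^ n) * 2 powr b" .
    have "c / \<omega> x \<le> (1 / 4 / 2 powr b) * (1 / \<omega> x)"
      using pos[OF x(1) x1] mult_right_mono[of c "1 / 4 / 2 powr b" "1 / \<omega> x"] by (simp add: c_def)
    also have "\<dots> \<le> (1 / 4 / 2 powr b) * (1 / \<omega> (1 - 1 / 2 ^ n) * 2 powr b)"
      by (rule mult_left_mono[OF V]) simp
    also have "\<dots> = 1 / 4 / \<omega> (1 - 1 / 2 ^ n)" by simp
    also have "\<dots> \<le> (1 - 1 / 2 ^ n) ^ (2 ^ n) / \<omega> (1 - 1 / 2 ^ n)"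
      using node_pos[OF \<open>k0 \<le> n\<close>] \<open>k0 \<le> n\<close> power_two_lower[of n]
      by (intro divide_right_mono) (auto simp: k0_def)
    also have "\<dots> \<le> x ^ (2 ^ n) / \<omega> (1 - 1 / 2 ^ n)"
      using node_pos[OF \<open>k0 \<le> n\<close>] le
      by (intro divide_right_mono power_mono) auto
    also have "\<dots> \<le> (\<Sum>k=k0..N. x ^ (2 ^ k) / \<omega> (1 - 1 / 2 ^ k))"
      using \<open>k0 \<le> n\<close> \<open>n \<le> N\<close> x node_pos
      by (intro member_le_sum) (auto intro!: divide_nonneg_pos)
    finally show ?thesis by (simp add: g_def)
  qed
  show ?thesis
    using that[OF \<open>0 < c\<close> \<open>0 < C\<close>, of k0] up lo unfolding g_def by blast
qed

subsection \<open>Norm estimates for the operator\<close>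

text \<open>On the slice p(u) = f(u e) the radial derivative is u p'(u), so on |u| = 1/2 it controls
  p' with a factor 2. The maximum principle for p' carries this bound inwards, where dividing by u
  would lose everything.\<close>

lemma slice_derivative_bound:
  fixes f :: "'a::complex_banach \<Rightarrow> complex"
  assumes f: "f \<in> holomorphic_ball" and e: "norm e = 1" and s: "0 \<le> s" "s \<le> 1/2"
    and B: "\<And>w. norm w = 1/2 \<Longrightarrow> cmod (radial_deriv f w) \<le> B"
  shows "cmod (fderiv f (s *\<^sub>R e) e) \<le> 2 * B"
proof -
  define p where "p = (\<lambda>u. f (0 + u *\<^sub>C e))"
  have p: "(p has_field_derivative fderiv f (0 + u *\<^sub>C e) e) (at u)" if "u \<in> ball 0 1" for u
    unfolding p_def by (rule DERIV_holomorphic_line[OF f]) (use that e in \<open>simp add: norm_scaleC\<close>)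
  have "p holomorphic_on ball 0 1"
    by (rule holomorphic_onI, rule field_differentiable_at_within)
      (use p in \<open>force simp: field_differentiable_def\<close>)
  then have hol: "deriv p holomorphic_on ball 0 1"
    by (rule holomorphic_deriv) simp
  have p': "deriv p u = fderiv f (u *\<^sub>C e) e" if "u \<in> ball 0 1" for u
    using DERIV_imp_deriv[OF p[OF that]] by simp
  have "cmod (deriv p (complex_of_real s)) \<le> 2 * B"
  proof (rule maximum_modulus_frontier[where S = "cball 0 (1/2)" and f = "deriv p" and \<xi> = "complex_of_real s"])
    show "deriv p holomorphic_on interior (cball 0 (1/2))"
      by (rule holomorphic_on_subset[OF hol]) auto
    show "continuous_on (closure (cball 0 (1/2))) (deriv p)"
      by (rule continuous_on_subset[OF holomorphic_on_imp_continuous_on[OF hol]]) auto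
    show "complex_of_real s \<in> cball 0 (1/2)" using s by simp
    fix u :: complex assume "u \<in> frontier (cball 0 (1/2))"
    then have u: "cmod u = 1/2" by simp
    have "radial_deriv f (u *\<^sub>C e) = u * fderiv f (u *\<^sub>C e) e"
      using u e by (simp add: radial_deriv_fderiv[OF f] fderiv_scaleC[OF f] norm_scaleC)
    then have "cmod (fderiv f (u *\<^sub>C e) e) = 2 * cmod (radial_deriv f (u *\<^sub>C e))"
      by (simp add: norm_mult u)
    then show "cmod (deriv p u) \<le> 2 * B"
      using B[of "u *\<^sub>C e"] u e by (simp add: p' norm_scaleC)
  qed simp
  then show ?thesis using s by (simp add: p' scaleC_of_real)
qed

lemma weight_inverse_integrable:
  assumes \<omega>: "normal_weight \<omega>" and "r < 1"
  shows "(\<lambda>t. 1 / \<omega> t) integrable_on {0..r}"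
proof (rule integrable_continuous_interval, rule continuous_on_divide)
  show "continuous_on {0..r} \<omega>"
    by (rule normal_weight_continuous[OF \<omega>]) (use \<open>r < 1\<close> in auto)
  show "\<forall>t\<in>{0..r}. \<omega> t \<noteq> 0"
    using normal_weight_pos[OF \<omega>] \<open>r < 1\<close> by (metis atLeastAtMost_iff less_irrefl le_less_trans)
qed (rule continuous_on_const)

lemma bloch_growth:
  assumes \<omega>: "normal_weight \<omega>"
  obtains K where "0 < K"
    "\<And>(f::'a::complex_banach \<Rightarrow> complex) B z.
       f \<in> holomorphic_ball \<Longrightarrow> (\<And>w. w \<in> ball 0 1 \<Longrightarrow> \<omega> (norm w) * cmod (radial_deriv f w) \<le> B) \<Longrightarrow>
       z \<in> ball 0 1 \<Longrightarrow> cmod (f z - f 0) \<le> K * B * integral {0..norm z} (\<lambda>t. 1 / \<omega> t)"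
proof -
  obtain m M where m: "0 < m" "\<And>r. 0 \<le> r \<Longrightarrow> r \<le> 1/2 \<Longrightarrow> m \<le> \<omega> r"
    and M: "\<And>r. 0 \<le> r \<Longrightarrow> r \<le> 1/2 \<Longrightarrow> \<omega> r \<le> M"
    using normal_weight_bounds[OF \<omega>, of "1/2"] by auto
  have "m \<le> M" using m(2)[of 0] M[of 0] by simp
  \<comment> \<open>The factor 2 comes from dividing by s > 1/2, or from the slice bound for s \<le>
    1/2; M/m compares values of \<omega> on [0,1/2].\<close>
  define K where "K = 2 * (M / m)"
  have "2 \<le> K" using \<open>m \<le> M\<close> m(1) by (simp add: K_def field_simps)
  show ?thesis
  proof (rule that)
    show "0 < K" using \<open>2 \<le> K\<close> by simp
    fix f :: "'a \<Rightarrow> complex" and B and z :: 'a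
    assume f: "f \<in> holomorphic_ball" and z: "z \<in> ball 0 1"
      and B: "\<And>w. w \<in> ball 0 1 \<Longrightarrow> \<omega> (norm w) * cmod (radial_deriv f w) \<le> B"
    have "0 \<le> B" using B[of 0] f by simp
    show "cmod (f z - f 0) \<le> K * B * integral {0..norm z} (\<lambda>t. 1 / \<omega> t)"
    proof (cases "z = 0")
      case False
      define r where "r = norm z"
      define e where "e = z /\<^sub>R r"
      have r: "0 < r" "r < 1" using z False by (auto simp: r_def)
      have e: "norm e = 1" "r *\<^sub>R e = z" using r by (simp_all add: e_def) (simp add: r_def)
      have in_ball: "0 + s *\<^sub>R e \<in> ball 0 1" if "0 \<le> s" "s \<le> r" for s
        using that e r by simp
      have FTC: "((\<lambda>s. fderiv f (0 + s *\<^sub>R e) e) has_integral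
          (f (0 + r *\<^sub>R e) - f (0 + 0 *\<^sub>R e))) {0..r}"
      proof (rule fundamental_theorem_of_calculus)
        fix s assume "s \<in> {0..r}"
        then show "((\<lambda>s. f (0 + s *\<^sub>R e)) has_vector_derivative fderiv f (0 + s *\<^sub>R e) e)
            (at s within {0..r})"
          by (intro has_vector_derivative_holomorphic_line[OF f] in_ball) auto
      qed (use r in simp)
      have bound: "cmod (fderiv f (0 + s *\<^sub>R e) e) \<le> K * B * (1 / \<omega> s)" if s: "s \<in> {0..r}" for s
      proof -
        have pos: "0 < \<omega> s" using s r normal_weight_pos[OF \<omega>] by simp
        show ?thesis
        proof (cases "s \<le> 1/2")
          case True
          have "cmod (radial_deriv f w) \<le> B / m" if w: "norm w = 1/2" for w
          proof -
            have "m * cmod (radial_deriv f w) \<le> \<omega> (norm w) * cmod (radial_deriv f w)"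
              unfolding w using m(2)[of "1/2"] by (intro mult_right_mono) auto
            also have "\<dots> \<le> B" using B w by simp
            finally show ?thesis using m(1) by (simp add: field_simps)
          qed
          then have "cmod (fderiv f (s *\<^sub>R e) e) \<le> 2 * (B / m)"
            using s True by (intro slice_derivative_bound[OF f e(1)]) auto
          also have "\<dots> = (K * B) * (1 / M)" using \<open>m \<le> M\<close> m(1) by (simp add: K_def)
          also have "\<dots> \<le> K * B * (1 / \<omega> s)"
            using M[of s] s True pos \<open>0 \<le> B\<close> \<open>2 \<le> K\<close>
            by (intro mult_left_mono divide_left_mono) auto
          finally show ?thesis by simp
        next
          case False
          have sb: "s *\<^sub>R e \<in> ball 0 1" using in_ball[of s] s by simp
          have "radial_deriv f (s *\<^sub>R e) = s *\<^sub>R fderiv f (s *\<^sub>R e) e"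
            using radial_deriv_fderiv[OF f sb] by (simp add: blinfun.scaleR_right)
          then have "cmod (radial_deriv f (s *\<^sub>R e)) = s * cmod (fderiv f (s *\<^sub>R e) e)"
            using False by simp
          moreover have "1/2 * cmod (fderiv f (s *\<^sub>R e) e) \<le> s * cmod (fderiv f (s *\<^sub>R e) e)"
            using False by (intro mult_right_mono) auto
          moreover have "cmod (radial_deriv f (s *\<^sub>R e)) \<le> B / \<omega> s"
            using B[OF sb] e pos s by (simp add: field_simps)
          ultimately have "cmod (fderiv f (s *\<^sub>R e) e) \<le> 2 * B * (1 / \<omega> s)" by simp
          also have "\<dots> \<le> K * B * (1 / \<omega> s)"
            using \<open>0 \<le> B\<close> \<open>2 \<le> K\<close> pos by (intro mult_right_mono) auto
          finally show ?thesis by simp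
        qed
      qed
      have "cmod (integral {0..r} (\<lambda>s. fderiv f (0 + s *\<^sub>R e) e))
          \<le> integral {0..r} (\<lambda>s. K * B * (1 / \<omega> s))"
        by (rule Henstock_Kurzweil_Integration.integral_norm_bound_integral)
          (use FTC bound weight_inverse_integrable[OF \<omega> r(2)] in
            \<open>auto simp del: times_divide_eq_right intro: integrable_on_mult_right\<close>)
      then show ?thesis
        using integral_unique[OF FTC] e
        by (simp add: r_def del: times_divide_eq_right)
    qed simp
  qed
qed

text \<open>Needed for the part f(0) of f, which multiplies the radial derivative of \<phi> without
  help from the integral. Away from the origin that integral is at least I0 and can be divided out;
  near the origin, where it vanishes, the slice bound takes over.\<close>

lemma symbol_bound:
  assumes \<omega>: "normal_weight \<omega>" and \<mu>: "normal_weight \<mu>"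
  obtains K where "0 < K"
    "\<And>(\<phi>::'a::complex_banach \<Rightarrow> complex) B z.
       \<phi> \<in> holomorphic_ball \<Longrightarrow> (\<And>w. w \<in> ball 0 1 \<Longrightarrow> cesaro_weight \<omega> \<mu> \<phi> w \<le> B) \<Longrightarrow>
       z \<in> ball 0 1 \<Longrightarrow> \<mu> (norm z) * cmod (radial_deriv \<phi> z) \<le> K * B"
proof -
  obtain m M where m: "0 < m" "\<And>r. 0 \<le> r \<Longrightarrow> r \<le> 1/2 \<Longrightarrow> m \<le> \<mu> r"
    and M: "\<And>r. 0 \<le> r \<Longrightarrow> r \<le> 1/2 \<Longrightarrow> \<mu> r \<le> M"
    using normal_weight_bounds[OF \<mu>, of "1/2"] by auto
  have "m \<le> M" using m(2)[of 0] M[of 0] by simp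
  define I0 where "I0 = integral {0..1/2} (\<lambda>t. 1 / \<omega> t)"
  have "0 < I0"
  proof -
    obtain m' M' where m': "0 < m'" "\<And>r. 0 \<le> r \<Longrightarrow> r \<le> 1/2 \<Longrightarrow> m' \<le> \<omega> r"
      and M': "\<And>r. 0 \<le> r \<Longrightarrow> r \<le> 1/2 \<Longrightarrow> \<omega> r \<le> M'"
      using normal_weight_bounds[OF \<omega>, of "1/2"] by auto
    have "m' \<le> M'" using m'(2)[of 0] M'[of 0] by simp
    have "integral {0..1/2::real} (\<lambda>t. 1 / M') \<le> I0"
      unfolding I0_def
    proof (rule integral_le)
      show "(\<lambda>t. 1 / \<omega> t) integrable_on {0..1/2}" by (rule weight_inverse_integrable[OF \<omega>]) simp
      show "1 / M' \<le> 1 / \<omega> t" if "t \<in> {0..1/2}" for t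
        using that M'[of t] m'(1) m'(2)[of t] by (intro divide_left_mono) auto
      show "(\<lambda>t. 1 / M') integrable_on {0..1/2::real}"
        by (intro integrable_continuous_interval continuous_intros)
    qed
    moreover have "0 < integral {0..1/2} (\<lambda>t::real. 1 / M')"
      using m'(1) \<open>m' \<le> M'\<close> by simp
    ultimately show ?thesis by linarith
  qed
  have I0: "I0 \<le> integral {0..r} (\<lambda>t. 1 / \<omega> t)" if "1/2 \<le> r" "r < 1" for r
    unfolding I0_def
    by (rule integral_subset_le)
      (use that weight_inverse_integrable[OF \<omega>] normal_weight_pos[OF \<omega>] in \<open>auto intro: less_imp_le\<close>)
  \<comment> \<open>I0 is the cost of removing the integral, M/m that of comparing values of \<mu>
    on [0,1/2]. The factor 2 of the slice bound is cancelled by \<open>norm z\<close> < 1/2.\<close>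
  define K where "K = M / m / I0"
  show ?thesis
  proof (rule that)
    show "0 < K" using \<open>0 < I0\<close> \<open>m \<le> M\<close> m(1) by (simp add: K_def)
    fix \<phi> :: "'a \<Rightarrow> complex" and B and z :: 'a
    assume \<phi>: "\<phi> \<in> holomorphic_ball" and z: "z \<in> ball 0 1"
      and B: "\<And>w. w \<in> ball 0 1 \<Longrightarrow> cesaro_weight \<omega> \<mu> \<phi> w \<le> B"
    have "0 \<le> B" using B[of 0] \<phi> by (simp add: cesaro_weight_def)
    have far: "\<mu> (norm w) * cmod (radial_deriv \<phi> w) \<le> B / I0" if w: "1/2 \<le> norm w" "norm w < 1" for w
    proof -
      have "\<mu> (norm w) * cmod (radial_deriv \<phi> w) * I0 \<le> cesaro_weight \<omega> \<mu> \<phi> w"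
        unfolding cesaro_weight_def using I0[OF w] normal_weight_pos[OF \<mu>, of "norm w"] w
        by (intro mult_left_mono) auto
      also have "\<dots> \<le> B" using B w by simp
      finally show ?thesis using \<open>0 < I0\<close> by (simp add: field_simps)
    qed
    show "\<mu> (norm z) * cmod (radial_deriv \<phi> z) \<le> K * B"
    proof (cases "1/2 \<le> norm z")
      case True
      then have "\<mu> (norm z) * cmod (radial_deriv \<phi> z) \<le> 1 * (B / I0)" using far z by simp
      also have "\<dots> \<le> (M / m) * (B / I0)"
        using \<open>0 < I0\<close> \<open>0 \<le> B\<close> \<open>m \<le> M\<close> m(1) by (intro mult_right_mono) auto
      finally show ?thesis by (simp add: K_def)
    next
      case small: False
      show ?thesis
      proof (cases "z = 0")
        case True
        then show ?thesis using \<phi> \<open>0 < K\<close> \<open>0 \<le> B\<close> by simp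
      next
        case False
        define r where "r = norm z"
        define e where "e = z /\<^sub>R r"
        have r: "0 < r" "r < 1/2" using small False by (auto simp: r_def)
        have e: "norm e = 1" "r *\<^sub>R e = z" using r by (simp_all add: e_def) (simp add: r_def)
        have "cmod (radial_deriv \<phi> w) \<le> B / I0 / m" if w: "norm w = 1/2" for w
        proof -
          have "m * cmod (radial_deriv \<phi> w) \<le> \<mu> (norm w) * cmod (radial_deriv \<phi> w)"
            unfolding w using m(2)[of "1/2"] by (intro mult_right_mono) auto
          also have "\<dots> \<le> B / I0" using far w by simp
          finally show ?thesis using m(1) pos_le_divide_eq[OF m(1), of _ "B / I0"] by (simp add: mult.commute)
        qed
        then have "cmod (fderiv \<phi> (r *\<^sub>R e) e) \<le> 2 * (B / I0 / m)"
          using r by (intro slice_derivative_bound[OF \<phi> e(1)]) auto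
        then have bd: "cmod (fderiv \<phi> z e) \<le> 2 * (B / I0 / m)" using e by simp
        have "radial_deriv \<phi> z = fderiv \<phi> z (r *\<^sub>R e)"
          using radial_deriv_fderiv[OF \<phi> z] e by simp
        then have "cmod (radial_deriv \<phi> z) = r * cmod (fderiv \<phi> z e)"
          using r by (simp add: blinfun.scaleR_right)
        also have "\<dots> \<le> 1/2 * (2 * (B / I0 / m))"
          using bd r by (intro mult_mono) auto
        finally have "cmod (radial_deriv \<phi> z) \<le> B / I0 / m" by simp
        then have "\<mu> (norm z) * cmod (radial_deriv \<phi> z) \<le> M * (B / I0 / m)"
          using M[of "norm z"] small m(1) \<open>m \<le> M\<close> by (intro mult_mono) auto
        then show ?thesis by (simp add: K_def mult_ac)
      qed
    qed
  qed
qed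

section \<open>The Bloch norm as a supremum\<close>

lemma bloch_space_le:
  assumes "f \<in> bloch_space \<omega>" "z \<in> ball 0 1"
  shows "\<omega> (norm z) * cmod (radial_deriv f z) \<le> bloch_norm \<omega> f - cmod (f 0)"
proof -
  have "bdd_above ((\<lambda>z. \<omega> (norm z) * cmod (radial_deriv f z)) ` ball 0 1)"
    using assms(1) by (simp add: bloch_space_def)
  from cSUP_upper[OF assms(2) this] show ?thesis
    unfolding bloch_norm_def by linarith
qed

lemma bloch_normI:
  fixes f :: "'a::complex_banach \<Rightarrow> complex"
  assumes f: "f \<in> holomorphic_ball"
    and B: "\<And>z. z \<in> ball 0 1 \<Longrightarrow> \<omega> (norm z) * cmod (radial_deriv f z) \<le> B"
  shows "f \<in> bloch_space \<omega>" "bloch_norm \<omega> f \<le> cmod (f 0) + B"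
proof -
  show "f \<in> bloch_space \<omega>"
    using f B by (auto simp: bloch_space_def simp del: mem_ball intro!: bdd_aboveI)
  have "(SUP z\<in>ball 0 1. \<omega> (norm z) * cmod (radial_deriv f z)) \<le> B"
    by (rule cSUP_least) (use B in auto)
  then show "bloch_norm \<omega> f \<le> cmod (f 0) + B" by (simp add: bloch_norm_def)
qed

lemma bloch_norm_nonneg:
  assumes "f \<in> bloch_space \<omega>" shows "0 \<le> bloch_norm \<omega> f"
proof -
  have "0 = \<omega> (norm (0::'a)) * cmod (radial_deriv f 0)"
    using assms by (simp add: bloch_space_def)
  also have "\<dots> \<le> bloch_norm \<omega> f - cmod (f 0)" by (rule bloch_space_le[OF assms]) simp
  finally show ?thesis using norm_ge_zero[of "f 0"] by linarith
qed

text \<open>Nonnegative coefficients give |g'(l z)| \<le> g(|l z|) \<le> g(\<open>norm z\<close>),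
  so a bound for the real polynomial g on [0,1) controls f on the whole ball. At z0 the functional l
  is real, and G(l z0) is exactly the integral of g up to \<open>norm z0\<close>.\<close>

lemma bloch_test_function:
  assumes \<omega>: "normal_weight \<omega>"
  obtains C where "0 < C"
    "\<And>z::'a::complex_banach. z \<in> ball 0 1 \<Longrightarrow> \<exists>f\<in>bloch_space \<omega>. bloch_norm \<omega> f \<le> 1 \<and>
       integral {0..norm z} (\<lambda>t. 1 / \<omega> t) \<le> C * cmod (f z)"
proof (rule lacunary_sum_bounds[OF \<omega>])
  fix c C :: real and k0 :: nat
  assume c: "0 < c" and C: "0 < C"
    and up: "\<And>x N. 0 \<le> x \<Longrightarrow> x < 1 \<Longrightarrow>
      1 + (\<Sum>k=k0..N. x ^ (2 ^ k) / \<omega> (1 - 1 / 2 ^ k)) \<le> C / \<omega> x"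
    and lo: "\<And>x N. 0 \<le> x \<Longrightarrow> x < 1 - 1 / 2 ^ Suc N \<Longrightarrow>
      c / \<omega> x \<le> 1 + (\<Sum>k=k0..N. x ^ (2 ^ k) / \<omega> (1 - 1 / 2 ^ k))"
  have node_pos: "0 < \<omega> (1 - 1 / 2 ^ k)" for k :: nat
    using one_le_power[of "2::real" k] by (intro normal_weight_pos[OF \<omega>]) (auto simp: field_simps)
  show ?thesis
  proof (rule that)
    \<comment> \<open>C is the divisor that normalises f to norm at most 1; c is the loss in the
      lower comparison of g with 1/\<omega>.\<close>
    show "0 < C / c" using c C by simp
    fix z0 :: 'a assume z0: "z0 \<in> ball 0 1"
    define r where "r = norm z0"
    have r: "0 \<le> r" "r < 1" using z0 by (auto simp: r_def)
    \<comment> \<open>Only the lower comparison restricts N, and only up to the radius r; the upper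
      one is uniform in N.\<close>
    obtain N where N: "(1/2::real) ^ N < 1 - r"
      using real_arch_pow_inv[of "1 - r" "1/2"] r by auto
    have "1 / 2 ^ Suc N \<le> (1/2::real) ^ N" by (simp add: power_one_over field_simps)
    with N have N: "r < 1 - 1 / 2 ^ Suc N" by linarith
    obtain l :: "'a \<Rightarrow> complex" where l: "bounded_linear l" "\<And>c x. l (c *\<^sub>C x) = c * l x"
      "\<And>x. cmod (l x) \<le> norm x" "l z0 = complex_of_real r"
      using norming_functional[of z0] unfolding r_def by metis
    define w where "w = (\<lambda>k::nat. \<omega> (1 - 1 / 2 ^ k))"
    have w: "0 < w k" for k using node_pos by (simp add: w_def)
    define g where "g = (\<lambda>x::real. 1 + (\<Sum>k=k0..N. x ^ (2 ^ k) / w k))"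
    define g' where "g' = (\<lambda>u::complex. 1 + (\<Sum>k=k0..N. u ^ (2 ^ k) / of_real (w k)))"
    define G where "G = (\<lambda>u::complex. u + (\<Sum>k=k0..N. u ^ Suc (2 ^ k) / of_nat (Suc (2 ^ k)) / of_real (w k)))"
    have DG: "(G has_field_derivative g' u) (at u)" for u
    proof -
      have "((\<lambda>u. u ^ Suc (2 ^ k) / of_nat (Suc (2 ^ k)) / of_real (w k))
          has_field_derivative u ^ (2 ^ k) / of_real (w k)) (at u)" for k
      proof -
        have "((\<lambda>u. u ^ Suc (2 ^ k)) has_field_derivative of_nat (Suc (2 ^ k)) * u ^ (2 ^ k)) (at u)"
          using DERIV_power_Suc[OF DERIV_ident, of "2 ^ k" u UNIV] by (simp del: power_Suc)
        then have "((\<lambda>u. u ^ Suc (2 ^ k) / of_nat (Suc (2 ^ k)) / of_real (w k)) has_field_derivative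
            of_nat (Suc (2 ^ k)) * u ^ (2 ^ k) / of_nat (Suc (2 ^ k)) / of_real (w k)) (at u)"
          by (intro DERIV_cdivide)
        then show ?thesis
          by (simp only: nonzero_mult_div_cancel_left of_nat_neq_0 not_False_eq_True)
      qed
      then show ?thesis
        unfolding G_def g'_def by (intro DERIV_add DERIV_ident DERIV_sum)
    qed
    have g'_le: "cmod (g' u) \<le> g (cmod u)" for u
    proof -
      have "cmod (g' u) \<le> 1 + (\<Sum>k=k0..N. cmod (u ^ (2 ^ k) / of_real (w k)))"
        unfolding g'_def by (rule order_trans[OF norm_triangle_ineq]) (simp add: norm_sum)
      also have "\<dots> = g (cmod u)"
        using w by (simp add: g_def norm_divide norm_power abs_of_pos)
      finally show ?thesis .
    qed
    have g_mono: "g x \<le> g y" if "0 \<le> x" "x \<le> y" for x y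
      unfolding g_def using that w
      by (intro add_left_mono sum_mono divide_right_mono power_mono) (auto intro: less_imp_le)
    define f where "f = (\<lambda>z. if z \<in> ball 0 1 then G (l z) / of_real C else 0)"
    have Df: "(f has_derivative (\<lambda>h. g' (l z) * l h / of_real C)) (at z)" if z: "z \<in> ball 0 1" for z
    proof -
      have "((\<lambda>z. G (l z)) has_derivative (\<lambda>h. g' (l z) * l h)) (at z)"
        using DG[of "l z"] unfolding has_field_derivative_def
        by (rule has_derivative_compose[OF bounded_linear_imp_has_derivative[OF l(1)]])
      then have "((\<lambda>z. G (l z) * inverse (of_real C)) has_derivative
          (\<lambda>h. g' (l z) * l h * inverse (of_real C))) (at z)"
        by (rule has_derivative_mult_left)
      then show ?thesis
        unfolding divide_inverse[symmetric]
        by (rule has_derivative_transform_within_open[where s = "ball 0 1"])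
          (use z in \<open>auto simp: f_def\<close>)
    qed
    have f: "f \<in> holomorphic_ball"
      unfolding holomorphic_ball_def
    proof (intro CollectI conjI ballI allI impI)
      fix z :: 'a assume "z \<in> ball 0 1"
      from Df[OF this] show "\<exists>D. (f has_derivative D) (at z) \<and> (\<forall>c x. D (c *\<^sub>C x) = c * D x)"
        by (intro exI conjI) (assumption, simp add: l(2))
    qed (simp add: f_def)
    have "\<omega> (norm z) * cmod (radial_deriv f z) \<le> 1" if z: "z \<in> ball 0 1" for z
    proof -
      have pos: "0 < \<omega> (norm z)" using normal_weight_pos[OF \<omega>] z by simp
      have "radial_deriv f z = g' (l z) * l z / of_real C" by (rule radial_deriv_eqI[OF Df[OF z]])
      then have "cmod (radial_deriv f z) = cmod (g' (l z)) * cmod (l z) / C"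
        using C by (simp add: norm_mult norm_divide)
      also have "\<dots> \<le> g (norm z) * 1 / C"
      proof (intro divide_right_mono mult_mono)
        show "cmod (g' (l z)) \<le> g (norm z)"
          using g'_le[of "l z"] g_mono[of "cmod (l z)" "norm z"] l(3)[of z] by simp
        show "cmod (l z) \<le> 1" using l(3)[of z] z by simp
        show "0 \<le> g (norm z)" using order_trans[OF norm_ge_zero g'_le[of "of_real (norm z)"]] by simp
      qed (use C in auto)
      also have "\<dots> \<le> C / \<omega> (norm z) / C"
        using up[of "norm z" N] z C by (intro divide_right_mono) (auto simp: g_def w_def)
      finally show ?thesis using pos C by (simp add: field_simps)
    qed
    note bloch = bloch_normI[OF f this]
    have "f 0 = 0" using l(1) by (simp add: f_def G_def linear_simps)
    have "integral {0..r} (\<lambda>t. 1 / \<omega> t) \<le> C / c * cmod (f z0)"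
    proof -
      have "((\<lambda>t. g' (complex_of_real t)) has_integral
          (G (complex_of_real r) - G (complex_of_real 0))) {0..r}"
        by (rule fundamental_theorem_of_calculus[OF r(1)])
          (rule has_vector_derivative_real_field[OF DG])
      from has_integral_linear[OF this bounded_linear_Re]
      have "((\<lambda>t. Re (g' (complex_of_real t))) has_integral Re (G (complex_of_real r))) {0..r}"
        by (simp add: o_def G_def)
      moreover have "Re (g' (complex_of_real t)) = g t" for t
      proof -
        have "g' (complex_of_real t) = complex_of_real (g t)" by (simp add: g'_def g_def)
        then show ?thesis by simp
      qed
      ultimately have G: "(g has_integral Re (G (complex_of_real r))) {0..r}" by simp
      have "integral {0..r} (\<lambda>t. c * (1 / \<omega> t)) \<le> Re (G (complex_of_real r))"
        unfolding integral_unique[OF G, symmetric]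
      proof (rule integral_le)
        show "(\<lambda>t. c * (1 / \<omega> t)) integrable_on {0..r}"
          using weight_inverse_integrable[OF \<omega> r(2)] by (rule integrable_on_mult_right)
        show "g integrable_on {0..r}" using G by blast
        show "c * (1 / \<omega> t) \<le> g t" if "t \<in> {0..r}" for t
          using lo[of t N] that N by (simp add: g_def w_def)
      qed
      also have "\<dots> \<le> cmod (G (complex_of_real r))" by (rule complex_Re_le_cmod)
      also have "\<dots> = C * cmod (f z0)" using z0 C l(4) by (simp add: f_def norm_divide)
      finally have "c * integral {0..r} (\<lambda>t. 1 / \<omega> t) \<le> C * cmod (f z0)"
        by (simp del: times_divide_eq_right)
      then show ?thesis using c by (simp add: field_simps)
    qed
    then show "\<exists>f\<in>bloch_space \<omega>. bloch_norm \<omega> f \<le> 1 \<and>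
        integral {0..norm z0} (\<lambda>t. 1 / \<omega> t) \<le> C / c * cmod (f z0)"
      using bloch \<open>f 0 = 0\<close> by (intro bexI[of _ f]) (simp_all add: r_def)
  qed
qed

text \<open>Splitting f(z) = f(0) + (f(z) - f(0)) gives the two constants: K2 from the symbol alone
  against f(0), K1 from the growth of f against the full weight.\<close>

lemma cesaro_bounded_above:
  assumes \<omega>: "normal_weight \<omega>" and \<mu>: "normal_weight \<mu>"
  obtains K where "0 < K"
    "\<And>(\<phi>::'a::complex_banach \<Rightarrow> complex) f B.
       \<phi> \<in> holomorphic_ball \<Longrightarrow> (\<And>w. w \<in> ball 0 1 \<Longrightarrow> cesaro_weight \<omega> \<mu> \<phi> w \<le> B) \<Longrightarrow>
       f \<in> bloch_space \<omega> \<Longrightarrow>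
       cesaro \<phi> f \<in> bloch_space \<mu> \<and> bloch_norm \<mu> (cesaro \<phi> f) \<le> K * B * bloch_norm \<omega> f"
proof -
  obtain K1 where K1: "0 < K1"
    "\<And>(f::'a \<Rightarrow> complex) B z.
       f \<in> holomorphic_ball \<Longrightarrow> (\<And>w. w \<in> ball 0 1 \<Longrightarrow> \<omega> (norm w) * cmod (radial_deriv f w) \<le> B) \<Longrightarrow>
       z \<in> ball 0 1 \<Longrightarrow> cmod (f z - f 0) \<le> K1 * B * integral {0..norm z} (\<lambda>t. 1 / \<omega> t)"
    using bloch_growth[OF \<omega>] by blast
  obtain K2 where K2: "0 < K2"
    "\<And>(\<phi>::'a \<Rightarrow> complex) B z.
       \<phi> \<in> holomorphic_ball \<Longrightarrow> (\<And>w. w \<in> ball 0 1 \<Longrightarrow> cesaro_weight \<omega> \<mu> \<phi> w \<le> B) \<Longrightarrow>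
       z \<in> ball 0 1 \<Longrightarrow> \<mu> (norm z) * cmod (radial_deriv \<phi> z) \<le> K2 * B"
    using symbol_bound[OF \<omega> \<mu>] by blast
  show ?thesis
  proof (rule that)
    show "0 < K1 + K2" using K1(1) K2(1) by simp
    fix \<phi> f :: "'a \<Rightarrow> complex" and B
    assume \<phi>: "\<phi> \<in> holomorphic_ball" and f: "f \<in> bloch_space \<omega>"
      and B: "\<And>w. w \<in> ball 0 1 \<Longrightarrow> cesaro_weight \<omega> \<mu> \<phi> w \<le> B"
    have hol: "f \<in> holomorphic_ball" using f by (simp add: bloch_space_def)
    have "0 \<le> B" using B[of 0] \<phi> by (simp add: cesaro_weight_def)
    define n where "n = bloch_norm \<omega> f"
    have n0: "cmod (f 0) \<le> n"
      using bloch_space_le[OF f, of 0] hol by (simp add: n_def)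
    have "0 \<le> n" using bloch_norm_nonneg[OF f] by (simp add: n_def)
    have "\<mu> (norm z) * cmod (radial_deriv (cesaro \<phi> f) z) \<le> (K1 + K2) * B * n"
      if z: "z \<in> ball 0 1" for z
    proof -
      define I where "I = integral {0..norm z} (\<lambda>t. 1 / \<omega> t)"
      define s where "s = \<mu> (norm z) * cmod (radial_deriv \<phi> z)"
      have "0 \<le> s" using normal_weight_pos[OF \<mu>, of "norm z"] z by (simp add: s_def)
      have sI: "s * I \<le> B" using B[OF z] by (simp add: cesaro_weight_def s_def I_def)
      have "s \<le> K2 * B" unfolding s_def by (rule K2(2)[OF \<phi> B z])
      have "\<omega> (norm w) * cmod (radial_deriv f w) \<le> n" if "w \<in> ball 0 1" for w
        using bloch_space_le[OF f that] norm_ge_zero[of "f 0"] unfolding n_def by linarith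
      then have "cmod (f z - f 0) \<le> K1 * n * I"
        unfolding I_def by (rule K1(2)[OF hol _ z])
      then have "cmod (f z) \<le> n + K1 * n * I"
        using n0 norm_triangle_ineq2[of "f z" "f 0"] by linarith
      then have "s * cmod (f z) \<le> s * (n + K1 * n * I)"
        using \<open>0 \<le> s\<close> by (rule mult_left_mono)
      also have "\<dots> = s * n + (s * I) * (K1 * n)" by (simp add: algebra_simps)
      also have "\<dots> \<le> (K2 * B) * n + B * (K1 * n)"
        using \<open>s \<le> K2 * B\<close> sI \<open>0 \<le> n\<close> K1(1) by (intro add_mono mult_right_mono) auto
      finally show ?thesis
        by (simp add: radial_deriv_cesaro[OF hol \<phi> z] norm_mult s_def algebra_simps)
    qed
    from bloch_normI[OF cesaro_holomorphic[OF hol \<phi>] this]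
    show "cesaro \<phi> f \<in> bloch_space \<mu> \<and> bloch_norm \<mu> (cesaro \<phi> f) \<le> (K1 + K2) * B * bloch_norm \<omega> f"
      by (simp add: cesaro_0[OF hol \<phi>] n_def)
  qed
qed

text \<open>The radial derivative of the image of a test function at z is f(z) times that of \<phi>,
  and |f(z)| dominates the integral up to a constant. That the image lies in
  \<open>bloch_space \<mu>\<close> makes its \<open>bloch_norm\<close> a genuine upper bound for
  pointwise values.\<close>

lemma cesaro_weight_le_bloch_norm:
  assumes \<omega>: "normal_weight \<omega>" and \<mu>: "normal_weight \<mu>"
  obtains C where "0 < C"
    "\<And>(\<phi>::'a::complex_banach \<Rightarrow> complex) z.
       \<phi> \<in> holomorphic_ball \<Longrightarrow> \<forall>f\<in>bloch_space \<omega>. cesaro \<phi> f \<in> bloch_space \<mu> \<Longrightarrow> z \<in> ball 0 1 \<Longrightarrow>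
       \<exists>f\<in>bloch_space \<omega>. bloch_norm \<omega> f \<le> 1 \<and>
         cesaro_weight \<omega> \<mu> \<phi> z \<le> C * bloch_norm \<mu> (cesaro \<phi> f)"
proof -
  obtain C where C: "0 < C"
    "\<And>z::'a. z \<in> ball 0 1 \<Longrightarrow> \<exists>f\<in>bloch_space \<omega>. bloch_norm \<omega> f \<le> 1 \<and>
       integral {0..norm z} (\<lambda>t. 1 / \<omega> t) \<le> C * cmod (f z)"
    using bloch_test_function[OF \<omega>] by blast
  show ?thesis
  proof (rule that)
    show "0 < C" by (rule C)
    fix \<phi> :: "'a \<Rightarrow> complex" and z :: 'a
    assume \<phi>: "\<phi> \<in> holomorphic_ball" and z: "z \<in> ball 0 1"
      and T: "\<forall>f\<in>bloch_space \<omega>. cesaro \<phi> f \<in> bloch_space \<mu>"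
    obtain f where f: "f \<in> bloch_space \<omega>" "bloch_norm \<omega> f \<le> 1"
      and I: "integral {0..norm z} (\<lambda>t. 1 / \<omega> t) \<le> C * cmod (f z)"
      using C(2)[OF z] by blast
    have hol: "f \<in> holomorphic_ball" using f by (simp add: bloch_space_def)
    have "cesaro_weight \<omega> \<mu> \<phi> z \<le> \<mu> (norm z) * cmod (radial_deriv \<phi> z) * (C * cmod (f z))"
      unfolding cesaro_weight_def using I normal_weight_pos[OF \<mu>, of "norm z"] z
      by (intro mult_left_mono) auto
    also have "\<dots> = C * (\<mu> (norm z) * cmod (radial_deriv (cesaro \<phi> f) z))"
      by (simp add: radial_deriv_cesaro[OF hol \<phi> z] norm_mult)
    also have "\<dots> \<le> C * bloch_norm \<mu> (cesaro \<phi> f)"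
    proof (rule mult_left_mono)
      show "\<mu> (norm z) * cmod (radial_deriv (cesaro \<phi> f) z) \<le> bloch_norm \<mu> (cesaro \<phi> f)"
        using bloch_space_le[OF T[rule_format, OF f(1)] z] norm_ge_zero[of "cesaro \<phi> f 0"]
        by linarith
    qed (use C(1) in simp)
    finally show "\<exists>f\<in>bloch_space \<omega>. bloch_norm \<omega> f \<le> 1 \<and>
        cesaro_weight \<omega> \<mu> \<phi> z \<le> C * bloch_norm \<mu> (cesaro \<phi> f)"
      using f by blast
  qed
qed

section \<open>The operator norm as a supremum over the unit ball of the Bloch space\<close>

lemma bloch_opnorm_upper:
  assumes "bloch_bounded \<omega> \<mu> T" "f \<in> bloch_space \<omega>" "bloch_norm \<omega> f \<le> 1"
  shows "bloch_norm \<mu> (T f) \<le> bloch_opnorm \<omega> \<mu> T"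
proof -
  obtain K where K: "\<And>f. f \<in> bloch_space \<omega> \<Longrightarrow> bloch_norm \<mu> (T f) \<le> K * bloch_norm \<omega> f"
    using assms(1) unfolding bloch_bounded_def by blast
  \<comment> \<open>The constant K in \<open>bloch_bounded\<close> may be negative; it is replaced
    by \<open>max K 0\<close> before the norm of f is bounded by 1.\<close>
  have "bloch_norm \<mu> (T f) \<le> max K 0" if f: "f \<in> bloch_space \<omega>" "bloch_norm \<omega> f \<le> 1" for f
  proof -
    have "bloch_norm \<mu> (T f) \<le> max K 0 * bloch_norm \<omega> f"
      by (rule order_trans[OF K[OF f(1)]]) (simp add: mult_right_mono bloch_norm_nonneg[OF f(1)])
    also have "\<dots> \<le> max K 0 * 1" using f(2) by (intro mult_left_mono) auto
    finally show ?thesis by simp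
  qed
  then show ?thesis
    unfolding bloch_opnorm_def using assms(2,3) by (intro cSUP_upper bdd_aboveI[of _ "max K 0"]) auto
qed

text \<open>Shows that the set over which \<open>bloch_opnorm\<close> takes its supremum is
  nonempty, so that a common bound passes to the supremum.\<close>

lemma zero_bloch_space:
  "(\<lambda>z::'a::complex_banach. 0) \<in> bloch_space \<omega>"
  "bloch_norm \<omega> (\<lambda>z::'a::complex_banach. 0) \<le> 0"
proof -
  have hol: "(\<lambda>z::'a. 0) \<in> holomorphic_ball"
    unfolding holomorphic_ball_def by (auto intro!: exI[of _ "\<lambda>h. 0"])
  have "\<omega> (norm z) * cmod (radial_deriv (\<lambda>z. 0) z) \<le> 0" for z :: 'a
    using radial_deriv_eqI[OF has_derivative_const[of 0 "at z"]] by simp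
  from bloch_normI[OF hol this] show "(\<lambda>z::'a. 0) \<in> bloch_space \<omega>" "bloch_norm \<omega> (\<lambda>z::'a. 0) \<le> 0"
    by auto
qed

theorem theorem3p2:
  fixes \<omega> \<mu> :: "real \<Rightarrow> real"
  assumes "normal_weight \<omega>" and "normal_weight \<mu>"
  shows "(\<forall>\<phi> \<in> (holomorphic_ball :: ('a::complex_banach \<Rightarrow> complex) set).
            bloch_bounded \<omega> \<mu> (cesaro \<phi>) \<longleftrightarrow> bdd_above (cesaro_weight \<omega> \<mu> \<phi> ` ball 0 1)) \<and>
         (\<exists>C>0. \<forall>\<phi> \<in> (holomorphic_ball :: ('a \<Rightarrow> complex) set).
            bloch_bounded \<omega> \<mu> (cesaro \<phi>) \<longrightarrow>
              inverse C * bloch_opnorm \<omega> \<mu> (cesaro \<phi>)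
                \<le> (SUP z\<in>ball 0 1. cesaro_weight \<omega> \<mu> \<phi> z) \<and>
              (SUP z\<in>ball 0 1. cesaro_weight \<omega> \<mu> \<phi> z)
                \<le> C * bloch_opnorm \<omega> \<mu> (cesaro \<phi>))"
proof -
  \<comment> \<open>K, and C below, are fixed before any \<phi> is chosen; this is the asserted
    independence of \<phi>.\<close>
  obtain K where K: "0 < K"
    "\<And>(\<phi>::'a \<Rightarrow> complex) f B.
       \<phi> \<in> holomorphic_ball \<Longrightarrow> (\<And>w. w \<in> ball 0 1 \<Longrightarrow> cesaro_weight \<omega> \<mu> \<phi> w \<le> B) \<Longrightarrow>
       f \<in> bloch_space \<omega> \<Longrightarrow>
       cesaro \<phi> f \<in> bloch_space \<mu> \<and> bloch_norm \<mu> (cesaro \<phi> f) \<le> K * B * bloch_norm \<omega> f"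
    using cesaro_bounded_above[OF assms] by blast
  obtain C where C: "0 < C"
    "\<And>(\<phi>::'a \<Rightarrow> complex) z.
       \<phi> \<in> holomorphic_ball \<Longrightarrow> \<forall>f\<in>bloch_space \<omega>. cesaro \<phi> f \<in> bloch_space \<mu> \<Longrightarrow> z \<in> ball 0 1 \<Longrightarrow>
       \<exists>f\<in>bloch_space \<omega>. bloch_norm \<omega> f \<le> 1 \<and>
         cesaro_weight \<omega> \<mu> \<phi> z \<le> C * bloch_norm \<mu> (cesaro \<phi> f)"
    using cesaro_weight_le_bloch_norm[OF assms] by blast
  have upper: "cesaro_weight \<omega> \<mu> \<phi> z \<le> C * bloch_opnorm \<omega> \<mu> (cesaro \<phi>)"
    if \<phi>: "\<phi> \<in> holomorphic_ball" and T: "bloch_bounded \<omega> \<mu> (cesaro \<phi>)" and z: "z \<in> ball 0 1"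
    for \<phi> :: "'a \<Rightarrow> complex" and z
  proof -
    have "\<forall>f\<in>bloch_space \<omega>. cesaro \<phi> f \<in> bloch_space \<mu>"
      using T by (simp add: bloch_bounded_def)
    from C(2)[OF \<phi> this z] obtain f where f: "f \<in> bloch_space \<omega>" "bloch_norm \<omega> f \<le> 1"
      "cesaro_weight \<omega> \<mu> \<phi> z \<le> C * bloch_norm \<mu> (cesaro \<phi> f)" by blast
    note f(3)
    also have "C * bloch_norm \<mu> (cesaro \<phi> f) \<le> C * bloch_opnorm \<omega> \<mu> (cesaro \<phi>)"
      using bloch_opnorm_upper[OF T f(1,2)] C(1) by (intro mult_left_mono) auto
    finally show ?thesis .
  qed
  have bdd: "bdd_above (cesaro_weight \<omega> \<mu> \<phi> ` ball 0 1)"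
    if "\<phi> \<in> holomorphic_ball" "bloch_bounded \<omega> \<mu> (cesaro \<phi>)" for \<phi> :: "'a \<Rightarrow> complex"
    using upper[OF that] by (auto simp del: mem_ball intro!: bdd_aboveI)
  have sup: "cesaro_weight \<omega> \<mu> \<phi> w \<le> (SUP z\<in>ball 0 1. cesaro_weight \<omega> \<mu> \<phi> z)"
    if "bdd_above (cesaro_weight \<omega> \<mu> \<phi> ` ball 0 1)" "w \<in> ball 0 1" for \<phi> :: "'a \<Rightarrow> complex" and w
    by (rule cSUP_upper[OF that(2,1)])
  have bounded: "bloch_bounded \<omega> \<mu> (cesaro \<phi>)"
    if \<phi>: "\<phi> \<in> holomorphic_ball" and W: "bdd_above (cesaro_weight \<omega> \<mu> \<phi> ` ball 0 1)"
    for \<phi> :: "'a \<Rightarrow> complex"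
    unfolding bloch_bounded_def
    using K(2)[OF \<phi> sup[OF W]] cesaro_add[OF _ _ \<phi>] cesaro_cmult[of \<phi>]
    by (auto simp: bloch_space_def)
  have lower: "inverse K * bloch_opnorm \<omega> \<mu> (cesaro \<phi>) \<le> (SUP z\<in>ball 0 1. cesaro_weight \<omega> \<mu> \<phi> z)"
    if \<phi>: "\<phi> \<in> holomorphic_ball" and T: "bloch_bounded \<omega> \<mu> (cesaro \<phi>)" for \<phi> :: "'a \<Rightarrow> complex"
  proof -
    define S where "S = (SUP z\<in>ball 0 1. cesaro_weight \<omega> \<mu> \<phi> z)"
    note W = bdd[OF \<phi> T]
    have "0 \<le> S" using sup[OF W, of 0] \<phi> by (simp add: S_def cesaro_weight_def)
    have "bloch_opnorm \<omega> \<mu> (cesaro \<phi>) \<le> K * S"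
      unfolding bloch_opnorm_def
    proof (rule cSUP_least)
      show "{f \<in> bloch_space \<omega>. bloch_norm \<omega> f \<le> 1} \<noteq> ({} :: ('a \<Rightarrow> complex) set)"
        using zero_bloch_space[of \<omega>] by (auto intro!: exI[of _ "\<lambda>z. 0"] intro: order_trans[OF _ zero_le_one])
      fix f assume f: "f \<in> {f \<in> (bloch_space \<omega> :: ('a \<Rightarrow> complex) set). bloch_norm \<omega> f \<le> 1}"
      then have "bloch_norm \<mu> (cesaro \<phi> f) \<le> K * S * bloch_norm \<omega> f"
        using K(2)[OF \<phi> sup[OF W]] by (simp add: S_def)
      also have "\<dots> \<le> K * S * 1"
        using f K(1) \<open>0 \<le> S\<close> by (intro mult_left_mono) auto
      finally show "bloch_norm \<mu> (cesaro \<phi> f) \<le> K * S" by simp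
    qed
    then show ?thesis using K(1) by (simp add: S_def field_simps)
  qed
  define D where "D = max K C"
  have D: "0 < D" "K \<le> D" "C \<le> D" using K(1) by (auto simp: D_def)
  have "inverse D * bloch_opnorm \<omega> \<mu> (cesaro \<phi>) \<le> (SUP z\<in>ball 0 1. cesaro_weight \<omega> \<mu> \<phi> z) \<and>
      (SUP z\<in>ball 0 1. cesaro_weight \<omega> \<mu> \<phi> z) \<le> D * bloch_opnorm \<omega> \<mu> (cesaro \<phi>)"
    if \<phi>: "\<phi> \<in> holomorphic_ball" and T: "bloch_bounded \<omega> \<mu> (cesaro \<phi>)" for \<phi> :: "'a \<Rightarrow> complex"
  proof
    \<comment> \<open>The weight vanishes at z = 0, so the upper estimate there shows that the
      operator norm is nonnegative. This permits replacing K and C by their maximum D.\<close>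
    have "0 \<le> C * bloch_opnorm \<omega> \<mu> (cesaro \<phi>)"
      using upper[OF \<phi> T, of 0] \<phi> by (simp add: cesaro_weight_def)
    then have N: "0 \<le> bloch_opnorm \<omega> \<mu> (cesaro \<phi>)" using C(1) by (simp add: zero_le_mult_iff)
    have "inverse D * bloch_opnorm \<omega> \<mu> (cesaro \<phi>) \<le> inverse K * bloch_opnorm \<omega> \<mu> (cesaro \<phi>)"
      using N D K(1) by (intro mult_right_mono le_imp_inverse_le) auto
    with lower[OF \<phi> T]
    show "inverse D * bloch_opnorm \<omega> \<mu> (cesaro \<phi>) \<le> (SUP z\<in>ball 0 1. cesaro_weight \<omega> \<mu> \<phi> z)"
      by linarith
    show "(SUP z\<in>ball 0 1. cesaro_weight \<omega> \<mu> \<phi> z) \<le> D * bloch_opnorm \<omega> \<mu> (cesaro \<phi>)"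
    proof (rule cSUP_least)
      fix z :: 'a assume z: "z \<in> ball 0 1"
      have "C * bloch_opnorm \<omega> \<mu> (cesaro \<phi>) \<le> D * bloch_opnorm \<omega> \<mu> (cesaro \<phi>)"
        using N D by (intro mult_right_mono)
      with upper[OF \<phi> T z] show "cesaro_weight \<omega> \<mu> \<phi> z \<le> D * bloch_opnorm \<omega> \<mu> (cesaro \<phi>)"
        by linarith
    qed simp
  qed
  then have "\<exists>C>0. \<forall>\<phi> \<in> (holomorphic_ball :: ('a \<Rightarrow> complex) set).
      bloch_bounded \<omega> \<mu> (cesaro \<phi>) \<longrightarrow>
        inverse C * bloch_opnorm \<omega> \<mu> (cesaro \<phi>) \<le> (SUP z\<in>ball 0 1. cesaro_weight \<omega> \<mu> \<phi> z) \<and>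
        (SUP z\<in>ball 0 1. cesaro_weight \<omega> \<mu> \<phi> z) \<le> C * bloch_opnorm \<omega> \<mu> (cesaro \<phi>)"
    using D(1) by (intro exI[of _ D]) simp
  moreover have "\<forall>\<phi> \<in> (holomorphic_ball :: ('a \<Rightarrow> complex) set).
      bloch_bounded \<omega> \<mu> (cesaro \<phi>) \<longleftrightarrow> bdd_above (cesaro_weight \<omega> \<mu> \<phi> ` ball 0 1)"
  proof (intro ballI iffI)
    fix \<phi> :: "'a \<Rightarrow> complex" assume \<phi>: "\<phi> \<in> holomorphic_ball"
    show "bdd_above (cesaro_weight \<omega> \<mu> \<phi> ` ball 0 1)" if "bloch_bounded \<omega> \<mu> (cesaro \<phi>)"
      by (rule bdd[OF \<phi> that])
    show "bloch_bounded \<omega> \<mu> (cesaro \<phi>)" if "bdd_above (cesaro_weight \<omega> \<mu> \<phi> ` ball 0 1)"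
      by (rule bounded[OF \<phi> that])
  qed
  ultimately show ?thesis by (rule conjI[rotated])
qed

end
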